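(* Every theta, every triangle-free closed theta, and every triangle-free wheel is an HC-obstruction. Moreover, these are the only HC-obstructions which are triangle-free; that is, a triangle-free graph is an HC-obstruction if and only if it is a theta, a closed theta, or a wheel.
   Context: Graphs are finite, without loops or parallel edges. A Hamiltonian cycle of a graph $G$ is a (not necessarily induced) subgraph of $G$ which is a cycle containing every vertex of $G$. A graph $H$ is an HC-obstruction if $H$ is $2$-connected, has no Hamiltonian cycle, and every induced subgraph of $H$ either equals $H$, or is not $2$-connected, or has a Hamiltonian cycle. A graph is triangle-free if it contains no clique on three vertices. A theta is a graph consisting of two non-adjacent vertices $u,v$ (the ends) and three paths $P_1,P_2,P_3$ from $u$ to $v$, each of length at least two, such that the sets $V(P_i)\setminus\{u,v\}$ ($i=1,2,3$) are pairwise disjoint and there are no edges between any two of them (and no other edges). A closed theta is the graph obtained from a theta with ends $u,v$ by adding the edge $uv$. A wheel is the graph consisting of a cycle $W$ together with a vertex $v \notin V(W)$ having at least three neighbours in $W$, whose edges are the edges of $W$ and the edges from $v$ to its neighbours in $W$ (so $W$ is an induced cycle of the wheel). *)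

theory Defs
  imports "Graph_Theory.Digraph_Component" "Graph_Theory.Vertex_Walk"
begin

text \<open>
  A finite graph without loops or parallel edges is a \<^typ>\<open>'a pair_pre_digraph\<close> satisfying
  \<^locale>\<open>pair_graph\<close>: every edge \<open>uv\<close> is represented by the two arcs \<open>(u,v)\<close> and \<open>(v,u)\<close>.
  Paths are given by their lists of vertices.
\<close>

definition list_edges :: "'a list \<Rightarrow> 'a rel" where
  "list_edges p = set (vwalk_arcs p) \<union> (set (vwalk_arcs p))\<inverse>"

definition path_between :: "'a \<Rightarrow> 'a list \<Rightarrow> 'a \<Rightarrow> bool" where
  "path_between u p v \<longleftrightarrow> p \<noteq> [] \<and> distinct p \<and> hd p = u \<and> last p = v"

definition is_cycle :: "'a pair_pre_digraph \<Rightarrow> bool" where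
  "is_cycle C \<longleftrightarrow> (\<exists>p. distinct p \<and> 3 \<le> length p \<and>
     C = \<lparr>pverts = set p, parcs = list_edges (p @ [hd p])\<rparr>)"

definition hamiltonian_cycle :: "'a pair_pre_digraph \<Rightarrow> 'a pair_pre_digraph \<Rightarrow> bool" where
  "hamiltonian_cycle C G \<longleftrightarrow> is_cycle C \<and> spanning (with_proj C) (with_proj G)"

text \<open>As usual, a 2-connected graph has more than two vertices.\<close>

definition two_connected :: "'a pair_pre_digraph \<Rightarrow> bool" where
  "two_connected G \<longleftrightarrow> 3 \<le> card (pverts G) \<and> connected (with_proj G) \<and>
     (\<forall>v \<in> pverts G. connected (with_proj G \<restriction> (pverts G - {v})))"

definition HC_obstruction :: "'a pair_pre_digraph \<Rightarrow> bool" where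
  "HC_obstruction H \<longleftrightarrow> two_connected H \<and> \<not> (\<exists>C. hamiltonian_cycle C H) \<and>
     (\<forall>K :: 'a pair_pre_digraph. induced_subgraph (with_proj K) (with_proj H) \<longrightarrow>
        K = H \<or> \<not> two_connected K \<or> (\<exists>C. hamiltonian_cycle C K))"

definition clique :: "'a pair_pre_digraph \<Rightarrow> 'a set \<Rightarrow> bool" where
  "clique G S \<longleftrightarrow> S \<subseteq> pverts G \<and> (\<forall>x \<in> S. \<forall>y \<in> S. x \<noteq> y \<longrightarrow> (x, y) \<in> parcs G)"

definition triangle_free :: "'a pair_pre_digraph \<Rightarrow> bool" where
  "triangle_free G \<longleftrightarrow> \<not> (\<exists>S. clique G S \<and> card S = 3)"

text \<open>
  The equation for \<open>G\<close> says that there are no edges besides those of the three paths;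
  in particular there are none between the interiors of two different paths.
\<close>

definition theta_with_ends :: "'a pair_pre_digraph \<Rightarrow> 'a \<Rightarrow> 'a \<Rightarrow> bool" where
  "theta_with_ends G u v \<longleftrightarrow> (u, v) \<notin> parcs G \<and>
     (\<exists>P1 P2 P3.
        path_between u P1 v \<and> path_between u P2 v \<and> path_between u P3 v \<and>
        2 \<le> vwalk_length P1 \<and> 2 \<le> vwalk_length P2 \<and> 2 \<le> vwalk_length P3 \<and>
        (set P1 - {u, v}) \<inter> (set P2 - {u, v}) = {} \<and>
        (set P1 - {u, v}) \<inter> (set P3 - {u, v}) = {} \<and>
        (set P2 - {u, v}) \<inter> (set P3 - {u, v}) = {} \<and>
        G = \<lparr>pverts = set P1 \<union> set P2 \<union> set P3,
             parcs = list_edges P1 \<union> list_edges P2 \<union> list_edges P3\<rparr>)"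

definition theta :: "'a pair_pre_digraph \<Rightarrow> bool" where
  "theta G \<longleftrightarrow> (\<exists>u v. theta_with_ends G u v)"

definition closed_theta :: "'a pair_pre_digraph \<Rightarrow> bool" where
  "closed_theta G \<longleftrightarrow> (\<exists>H u v. theta_with_ends H u v \<and>
     G = \<lparr>pverts = pverts H, parcs = parcs H \<union> {(u, v), (v, u)}\<rparr>)"

text \<open>\<open>N\<close> is the set of neighbours of the hub \<open>v\<close> on the rim \<open>W\<close>.\<close>

definition wheel :: "'a pair_pre_digraph \<Rightarrow> bool" where
  "wheel G \<longleftrightarrow> (\<exists>W v N. is_cycle W \<and> v \<notin> pverts W \<and> N \<subseteq> pverts W \<and> 3 \<le> card N \<and>
     G = \<lparr>pverts = insert v (pverts W), parcs = parcs W \<union> {v} \<times> N \<union> N \<times> {v}\<rparr>)"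

end

theory Submission
  imports Defs
begin

text \<open>
  In a theta or closed theta the interior vertices of the paths have degree two, so a Hamiltonian
  cycle would use three edges at an end; in a wheel it would visit the hub between two consecutive
  vertices of the rim, which form a triangle with the hub. For the converse it suffices to show that a 2-connected triangle-free graph
  containing none of them as an induced subgraph is Hamiltonian. Take an induced cycle \<open>W\<close> and a
  component \<open>K\<close> of its complement. If \<open>K\<close> attaches to two non-adjacent vertices of \<open>W\<close>, then a
  shortest path in \<open>K\<close> between two such attachments yields an induced theta or wheel, since there
  are no triangles. Otherwise \<open>K\<close> attaches to the two ends of one edge, so that the graph is \<open>W\<close>
  or has an edge \<open>uv\<close> whose ends form a cutset. Three components of \<open>G - {u, v}\<close> give an induced
  closed theta. With two components one glues Hamiltonian cycles of both sides along \<open>uv\<close>; the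
  induction works for the stronger claim that some Hamiltonian cycle contains every edge whose
  ends do not form a cutset.
\<close>

section \<open>Edge sets of vertex lists\<close>

text \<open>The gluing step dictates the induction claim. Hamiltonian cycles of the two sides can be
  joined along \<open>uv\<close> only if both run through \<open>uv\<close>, so the claim must name
  edges that lie on the cycle. Edges whose ends leave the rest connected are the right choice:
  \<open>uv\<close> is one in each side, where deleting \<open>u\<close> and \<open>v\<close> leaves
  a single component; it is not one in the whole graph, so the glued cycle may drop it; and any
  other such edge of the whole graph is one in the side that contains it. Everything takes place in
  one fixed symmetric relation, with vertex sets in place of induced subgraphs. Thetas and closed
  thetas then differ in one pair only, and a single predicate that ignores this pair serves both.
  Shortest paths are chosen among all paths whose ends satisfy a given relation, not between two
  fixed vertices. This stronger minimality is what controls further edges between the path and the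
  rest. Triangle-freeness cooperates: distinct neighbours of one vertex are non-adjacent, so they
  already form a candidate pair of attachments.\<close>

lemma list_edges_Nil [simp]: "list_edges [] = {}"
  and list_edges_single [simp]: "list_edges [x] = {}"
  and list_edges_Cons_Cons [simp]:
    "list_edges (x # y # p) = insert (x, y) (insert (y, x) (list_edges (y # p)))"
  by (auto simp: list_edges_def)

lemma list_edges_append:
  assumes "p \<noteq> []" "q \<noteq> []"
  shows "list_edges (p @ q) =
    insert (last p, hd q) (insert (hd q, last p) (list_edges p \<union> list_edges q))"
  using vwalk_arcs_append[OF assms] by (auto simp: list_edges_def)

lemma list_edges_Cons:
  "p \<noteq> [] \<Longrightarrow> list_edges (x # p) = insert (x, hd p) (insert (hd p, x) (list_edges p))"
  by (cases p) auto

lemma list_edges_snoc: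
  "p \<noteq> [] \<Longrightarrow> list_edges (p @ [x]) = insert (last p, x) (insert (x, last p) (list_edges p))"
  by (simp add: list_edges_append)

lemma list_edges_split: "list_edges (p @ x # q) = list_edges (p @ [x]) \<union> list_edges (x # q)"
  by (cases "p = []") (auto simp: list_edges_append)

lemma list_edges_sym: "(x, y) \<in> list_edges p \<longleftrightarrow> (y, x) \<in> list_edges p"
  by (auto simp: list_edges_def)

lemma list_edges_subset: "list_edges p \<subseteq> set p \<times> set p"
  by (induction p rule: induct_list012) auto

lemma list_edges_mem: "(x, y) \<in> list_edges p \<Longrightarrow> x \<in> set p \<and> y \<in> set p"
  using list_edges_subset by fastforce

lemma list_edges_rev [simp]: "list_edges (rev p) = list_edges p"
proof (induction p)
  case (Cons x p)
  then show ?case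
    by (cases "p = []") (auto simp: list_edges_snoc list_edges_Cons last_rev)
qed simp

lemma list_edges_nth:
  "(x, y) \<in> list_edges p \<longleftrightarrow>
    (\<exists>i. Suc i < length p \<and> (x = p ! i \<and> y = p ! Suc i \<or> y = p ! i \<and> x = p ! Suc i))"
proof (induction p rule: induct_list012)
  case (3 a b p)
  have "(\<exists>i. Suc i < length (a # b # p) \<and> Q i) \<longleftrightarrow> Q 0 \<or> (\<exists>i. Suc i < length (b # p) \<and> Q (Suc i))"
    for Q
    by (metis (no_types, lifting) Suc_less_eq length_Cons not0_implies_Suc zero_less_Suc)
  from this[of "\<lambda>i. x = (a # b # p) ! i \<and> y = (a # b # p) ! Suc i \<or> y = (a # b # p) ! i \<and> x = (a # b # p) ! Suc i"]
  show ?case using 3 by auto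
qed auto

lemma list_edges_append_subset: "list_edges p \<subseteq> list_edges (p @ q)" "list_edges q \<subseteq> list_edges (p @ q)"
  by (cases "p = []"; cases "q = []"; auto simp: list_edges_append)+

lemma list_edges_append_Int:
  assumes "distinct (p @ q)"
  shows "list_edges (p @ q) \<inter> set p \<times> set p = list_edges p"
    "list_edges (p @ q) \<inter> set q \<times> set q = list_edges q"
proof -
  have *: "set p \<inter> set q = {}" using assms by auto
  show "list_edges (p @ q) \<inter> set p \<times> set p = list_edges p"
    using * list_edges_subset[of p] list_edges_subset[of q] hd_in_set[of q]
    by (cases "p = []"; cases "q = []") (auto simp: list_edges_append)
  show "list_edges (p @ q) \<inter> set q \<times> set q = list_edges q"
    using * list_edges_subset[of p] list_edges_subset[of q] last_in_set[of p]
    by (cases "p = []"; cases "q = []") (fastforce simp: list_edges_append)+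
qed

lemma path_interior_neighbours:
  assumes "distinct (u # I @ [v])" "x \<in> set I"
  obtains a b where "\<And>y. (x, y) \<in> list_edges (u # I @ [v]) \<longleftrightarrow> y = a \<or> y = b"
proof -
  obtain A B where I: "I = A @ x # B" using assms(2) split_list by metis
  define A' where "A' = u # A"
  define B' where "B' = B @ [v]"
  have eq: "u # I @ [v] = A' @ x # B'" and ne: "A' \<noteq> []" "B' \<noteq> []"
    by (auto simp: I A'_def B'_def)
  have "(x, y) \<in> list_edges (A' @ x # B') \<longleftrightarrow> y = last A' \<or> y = hd B'" for y
    using assms(1) ne list_edges_mem[of x y A'] list_edges_mem[of x y B'] unfolding eq
    by (auto simp: list_edges_append list_edges_Cons)
  then show ?thesis using that eq by metis
qed

section \<open>Cycles as cyclic vertex lists\<close>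

abbreviation cycle_edges :: "'a list \<Rightarrow> 'a rel" where
  "cycle_edges p \<equiv> list_edges (p @ [hd p])"

lemma cycle_edges_eq:
  "p \<noteq> [] \<Longrightarrow> cycle_edges p = insert (last p, hd p) (insert (hd p, last p) (list_edges p))"
  by (simp add: list_edges_snoc)

lemma cycle_edges_subset: "cycle_edges p \<subseteq> set p \<times> set p"
  using list_edges_subset[of "p @ [hd p]"] by (cases p) auto

lemma cycle_edges_sym: "(x, y) \<in> cycle_edges p \<longleftrightarrow> (y, x) \<in> cycle_edges p"
  by (rule list_edges_sym)

lemma cycle_edges_rotate: "cycle_edges (p @ q) = cycle_edges (q @ p)"
  by (cases "p = []"; cases "q = []") (auto simp: list_edges_append)

lemma cycle_edges_rev: "cycle_edges (rev p) = cycle_edges p"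
proof (cases "p = []")
  case False
  then show ?thesis
    by (simp add: list_edges_snoc hd_rev last_rev insert_commute)
qed simp

text \<open>Normal form: any vertex may be put at the head, so local facts about a cycle need a
  proof only there.\<close>

lemma cycle_rotate_to:
  assumes "x \<in> set w" "distinct w"
  obtains q where "distinct (x # q)" "set (x # q) = set w" "cycle_edges (x # q) = cycle_edges w"
    "length (x # q) = length w"
proof -
  obtain a b where w: "w = a @ x # b" using assms(1) split_list by metis
  show ?thesis
    using that[of "b @ a"] assms(2) cycle_edges_rotate[of a "x # b"]
    by (auto simp: w)
qed

lemma cycle_edges_neighbours_hd:
  assumes "distinct (x # q)" "3 \<le> length (x # q)"
  shows "(x, y) \<in> cycle_edges (x # q) \<longleftrightarrow> y = hd q \<or> y = last q" "hd q \<noteq> last q"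
    "hd q \<in> set q" "last q \<in> set q"
proof -
  have q: "q \<noteq> []" using assms(2) by auto
  then show "(x, y) \<in> cycle_edges (x # q) \<longleftrightarrow> y = hd q \<or> y = last q"
    using assms(1) list_edges_mem[of x y q]
    by (auto simp: list_edges_snoc list_edges_Cons)
  show "hd q \<noteq> last q"
    using assms by (cases q) (auto simp: Suc_le_eq)
  show "hd q \<in> set q" "last q \<in> set q" using q by auto
qed

lemma cycle_degree:
  assumes "distinct w" "3 \<le> length w" "x \<in> set w"
  obtains a b where "a \<noteq> b" "a \<in> set w" "b \<in> set w" "a \<noteq> x" "b \<noteq> x"
    "\<And>y. (x, y) \<in> cycle_edges w \<longleftrightarrow> y = a \<or> y = b"
proof -
  obtain q where q: "distinct (x # q)" "set (x # q) = set w" "cycle_edges (x # q) = cycle_edges w"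
    "length (x # q) = length w"
    using cycle_rotate_to[OF assms(3,1)] .
  have len: "3 \<le> length (x # q)" using assms(2) q(4) by simp
  note n = cycle_edges_neighbours_hd[OF q(1) len]
  show ?thesis
    using that[OF n(2)] n q by (metis distinct.simps(2) list.set_intros(2))
qed

text \<open>Cuts a cycle open at an edge, turning it into a path with prescribed first and last
  vertex. The cycle may run through the edge in either direction; in one case the list is traversed
  backwards.\<close>

lemma cycle_open_at_edge:
  assumes "distinct w" "3 \<le> length w" "(u, v) \<in> cycle_edges w"
  obtains p where "distinct p" "set p = set w" "length p = length w" "hd p = u" "last p = v"
    "cycle_edges p = cycle_edges w"
proof -
  have "u \<in> set w" using assms(3) cycle_edges_subset by fastforce
  then obtain q where q: "distinct (u # q)" "set (u # q) = set w"
      "cycle_edges (u # q) = cycle_edges w" "length (u # q) = length w"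
    using cycle_rotate_to assms(1) by metis
  have len: "3 \<le> length (u # q)" using assms(2) q(4) by simp
  have qn: "q \<noteq> []" using len by auto
  consider "v = last q" | "v = hd q"
    using cycle_edges_neighbours_hd(1)[OF q(1) len] assms(3) q(3) by auto
  then show ?thesis
  proof cases
    case 1
    then show ?thesis using that[of "u # q"] q qn by simp
  next
    case 2
    have "cycle_edges (u # rev q) = cycle_edges (u # q)"
      using cycle_edges_rotate[of "[u]" "rev q"] cycle_edges_rev[of "u # q"] by simp
    then show ?thesis using that[of "u # rev q"] q qn 2 by (simp add: last_rev)
  qed
qed

section \<open>Connectivity\<close>

text \<open>Connectedness by cuts: each nonempty proper subset is left by an arc. For an arbitrary
  relation this is strong connectivity. The form yields the crossing edge directly;
  \<open>conn_walk\<close> recovers walks, and \<open>conn_iff_rtrancl_on\<close> compares it with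
  reachability.\<close>

definition conn :: "'a rel \<Rightarrow> 'a set \<Rightarrow> bool" where
  "conn E S \<longleftrightarrow> S \<noteq> {} \<and>
     (\<forall>M. M \<subseteq> S \<longrightarrow> M \<noteq> {} \<longrightarrow> M \<noteq> S \<longrightarrow> (\<exists>a \<in> M. \<exists>b \<in> S - M. (a, b) \<in> E))"

text \<open>Like \<open>conn\<close> and \<open>ham\<close>, this depends on \<open>E\<close> only
  through its restriction to \<open>S\<close>, so a vertex set stands for the subgraph that it
  induces.\<close>

definition two_conn :: "'a rel \<Rightarrow> 'a set \<Rightarrow> bool" where
  "two_conn E S \<longleftrightarrow> 3 \<le> card S \<and> conn E S \<and> (\<forall>v \<in> S. conn E (S - {v}))"

definition ham :: "'a rel \<Rightarrow> 'a set \<Rightarrow> bool" where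
  "ham E S \<longleftrightarrow> (\<exists>p. distinct p \<and> 3 \<le> length p \<and> set p = S \<and> cycle_edges p \<subseteq> E)"

lemma connD:
  assumes "conn E S" "M \<subseteq> S" "M \<noteq> {}" "M \<noteq> S"
  obtains a b where "a \<in> M" "b \<in> S" "b \<notin> M" "(a, b) \<in> E"
  using assms unfolding conn_def by blast

lemma connI:
  assumes "S \<noteq> {}"
    and "\<And>M. M \<subseteq> S \<Longrightarrow> M \<noteq> {} \<Longrightarrow> M \<noteq> S \<Longrightarrow> \<exists>a b. a \<in> M \<and> b \<in> S \<and> b \<notin> M \<and> (a, b) \<in> E"
  shows "conn E S"
  using assms unfolding conn_def by blast

lemma conn_insert:
  assumes "conn E S" "a \<in> S" "(a, x) \<in> E" "(x, a) \<in> E"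
  shows "conn E (insert x S)"
proof (cases "x \<in> S")
  case False
  show ?thesis
  proof (rule connI)
    fix M assume M: "M \<subseteq> insert x S" "M \<noteq> {}" "M \<noteq> insert x S"
    show "\<exists>a b. a \<in> M \<and> b \<in> insert x S \<and> b \<notin> M \<and> (a, b) \<in> E"
    \<comment> \<open>In the first case \<open>M\<close> is \<open>{x}\<close> or \<open>S\<close>,
      and one of the two arcs between \<open>a\<close> and \<open>x\<close> leaves it. Otherwise
      \<open>M - {x}\<close> is a cut of \<open>S\<close>.\<close>
    proof (cases "M - {x} = {} \<or> M - {x} = S")
      case True
      then show ?thesis using M assms False by blast
    next
      case F: False
      have "M - {x} \<subseteq> S" using M by blast
      then obtain c d where "c \<in> M - {x}" "d \<in> S" "d \<notin> M - {x}" "(c, d) \<in> E"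
        using connD[OF assms(1), of "M - {x}"] F by metis
      then show ?thesis using False by blast
    qed
  qed simp
qed (use assms in \<open>simp add: insert_absorb\<close>)

lemma conn_singleton: "conn E {x}"
  by (rule connI) auto

text \<open>A cut that splits neither set contains each of them entirely or misses it, and a common
  vertex forces the same choice for both.\<close>

lemma conn_union:
  assumes "conn E A" "conn E B" "A \<inter> B \<noteq> {}"
  shows "conn E (A \<union> B)"
proof (rule connI)
  fix M assume M: "M \<subseteq> A \<union> B" "M \<noteq> {}" "M \<noteq> A \<union> B"
  consider "M \<inter> A \<noteq> {}" "M \<inter> A \<noteq> A" | "M \<inter> B \<noteq> {}" "M \<inter> B \<noteq> B"
    using M assms(3) by blast
  then show "\<exists>a b. a \<in> M \<and> b \<in> A \<union> B \<and> b \<notin> M \<and> (a, b) \<in> E"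
  proof cases
    case 1
    then show ?thesis using connD[OF assms(1), of "M \<inter> A"] by (metis IntE IntI Un_iff inf_le2)
  next
    case 2
    then show ?thesis using connD[OF assms(2), of "M \<inter> B"] by (metis IntE IntI Un_iff inf_le2)
  qed
qed (use assms in \<open>auto simp: conn_def\<close>)

lemma conn_list:
  assumes "p \<noteq> []" "list_edges p \<subseteq> E"
  shows "conn E (set p)"
  using assms
proof (induction p rule: induct_list012)
  case (3 x y p)
  then have "conn E (set (y # p))" by simp
  then have "conn E (insert x (set (y # p)))"
    by (rule conn_insert[of _ _ y]) (use 3 in auto)
  then show ?case by simp
qed (auto simp: conn_singleton)

lemma two_conn_cycle:
  assumes "distinct w" "3 \<le> length w" "cycle_edges w \<subseteq> E"
  shows "two_conn E (set w)"
  unfolding two_conn_def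
proof (intro conjI ballI)
  show "3 \<le> card (set w)" using assms by (simp add: distinct_card)
  have "w \<noteq> []" using assms(2) by auto
  then show "conn E (set w)" using assms by (intro conn_list) (auto simp: cycle_edges_eq)
next
  fix v assume "v \<in> set w"
  then obtain q where q: "distinct (v # q)" "set (v # q) = set w"
      "cycle_edges (v # q) = cycle_edges w" "length (v # q) = length w"
    using cycle_rotate_to assms(1) by metis
  have "q \<noteq> []" using q(4) assms(2) by auto
  then have "list_edges q \<subseteq> E" using q(3) assms(3) by (auto simp: list_edges_snoc list_edges_Cons)
  then have "conn E (set q)" using conn_list \<open>q \<noteq> []\<close> by metis
  moreover have "set w - {v} = set q" using q(1,2) by auto
  ultimately show "conn E (set w - {v})" by simp
qed

text \<open>Adding an open ear. If a vertex of the ear is deleted, the two remaining pieces still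
  hang on \<open>S\<close> by their outer ends; if a vertex off the ear is deleted, the ear stays
  whole and attached.\<close>

lemma two_conn_ear:
  assumes S: "two_conn E S" and p: "distinct p" "list_edges p \<subseteq> E" "p \<noteq> []"
    and ends: "hd p \<in> S" "last p \<in> S" "hd p \<noteq> last p"
    and int: "set p \<inter> S \<subseteq> {hd p, last p}"
  shows "two_conn E (S \<union> set p)"
  unfolding two_conn_def
proof (intro conjI ballI)
  have fin: "finite S" "3 \<le> card S" using S unfolding two_conn_def by (auto intro: card_ge_0_finite)
  have "card S \<le> card (S \<union> set p)" using fin by (intro card_mono) auto
  then show "3 \<le> card (S \<union> set p)" using fin by linarith
  show "conn E (S \<union> set p)"
    using S p ends by (intro conn_union conn_list) (auto simp: two_conn_def dest: hd_in_set)
next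
  fix x assume x: "x \<in> S \<union> set p"
  have pieces: "conn E (S - {x} \<union> set q)"
    if "conn E (S - {x})" "list_edges q \<subseteq> E" "q = [] \<or> hd q \<in> S - {x} \<or> last q \<in> S - {x}" for q
  proof (cases "q = []")
    case False
    then have "conn E (set q)" using conn_list that(2) by metis
    then show ?thesis using that False by (intro conn_union) (auto dest: hd_in_set last_in_set)
  qed (use that in simp)
  have cSx: "conn E (S - {x})"
    using S by (cases "x \<in> S") (auto simp: two_conn_def)
  show "conn E (S \<union> set p - {x})"
  proof (cases "x \<in> set p")
    case False
    then have "x \<noteq> hd p" using p(3) by auto
    then have "conn E (S - {x} \<union> set p)" using pieces[OF cSx p(2)] ends by blast
    moreover have "S - {x} \<union> set p = S \<union> set p - {x}" using False by auto
    ultimately show ?thesis by simp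
  next
    case True
    then obtain a b where ab: "p = a @ x # b" using split_list by metis
    have 1: "conn E (S - {x} \<union> set a)"
    proof (rule pieces[OF cSx])
      show "list_edges a \<subseteq> E" using p(2) by (cases "a = []") (auto simp: ab list_edges_append)
      show "a = [] \<or> hd a \<in> S - {x} \<or> last a \<in> S - {x}"
        using ends(1) p(1) by (cases a) (auto simp: ab)
    qed
    have e: "list_edges b \<subseteq> E"
      using p(2) by (cases "a = []"; cases "b = []") (auto simp: ab list_edges_append list_edges_Cons)
    have "last b \<in> S - {x}" if "b \<noteq> []"
      using ends(2) p(1) that by (auto simp: ab)
    then have 2: "conn E (S - {x} \<union> set b)" using pieces[OF cSx e] by blast
    have "S - {x} \<noteq> {}" using cSx by (simp add: conn_def)
    then have "conn E ((S - {x} \<union> set a) \<union> (S - {x} \<union> set b))"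
      using conn_union[OF 1 2] by blast
    moreover have "S \<union> set p - {x} = (S - {x} \<union> set a) \<union> (S - {x} \<union> set b)"
      using p(1) by (auto simp: ab)
    ultimately show ?thesis by simp
  qed
qed

text \<open>The second neighbour is found after deleting the first: the graph that remains is still
  connected and has another vertex.\<close>

lemma two_conn_degree:
  assumes "two_conn E S" "x \<in> S"
  obtains a b where "a \<in> S" "b \<in> S" "a \<noteq> b" "a \<noteq> x" "b \<noteq> x" "(x, a) \<in> E" "(x, b) \<in> E"
proof -
  have c: "3 \<le> card S" "conn E S" using assms by (auto simp: two_conn_def)
  have fin: "finite S" using c(1) by (auto intro: card_ge_0_finite)
  have "{x} \<noteq> S" using c(1) by auto
  then obtain a where a: "a \<in> S" "a \<noteq> x" "(x, a) \<in> E"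
    using connD[OF c(2), of "{x}"] assms(2) by auto
  have "conn E (S - {a})" using assms a by (auto simp: two_conn_def)
  moreover have "{x} \<noteq> S - {a}"
  proof
    assume "{x} = S - {a}"
    then have "S = {x, a}" using a assms(2) by auto
    then have "card S \<le> 2" by (simp add: card_insert_if)
    then show False using c(1) by simp
  qed
  moreover have "{x} \<subseteq> S - {a}" using a assms(2) by auto
  ultimately obtain b where "b \<in> S - {a}" "b \<noteq> x" "(x, b) \<in> E"
    using connD[of E "S - {a}" "{x}"] by auto
  then show ?thesis using that a by auto
qed


section \<open>Thetas and wheels on a vertex set\<close>

lemma cycle_edges_two_paths:
  "cycle_edges (u # I @ v # rev J) = list_edges (u # I @ [v]) \<union> list_edges (u # J @ [v])"
proof -
  have "list_edges (v # rev J @ [u]) = list_edges (u # J @ [v])"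
    using list_edges_rev[of "u # J @ [v]"] by simp
  then show ?thesis
    using list_edges_split[of "u # I" v "rev J @ [u]"] by simp
qed

text \<open>The lists \<open>I1\<close>, \<open>I2\<close>, \<open>I3\<close> are the interiors of the three paths; the edge \<open>uv\<close> may be
  present or not, so that both thetas and closed thetas are covered.\<close>

definition theta_on :: "'a rel \<Rightarrow> 'a set \<Rightarrow> 'a \<Rightarrow> 'a \<Rightarrow> 'a list \<Rightarrow> 'a list \<Rightarrow> 'a list \<Rightarrow> bool" where
  "theta_on E S u v I1 I2 I3 \<longleftrightarrow> I1 \<noteq> [] \<and> I2 \<noteq> [] \<and> I3 \<noteq> [] \<and>
     distinct (u # v # I1 @ I2 @ I3) \<and> S = {u, v} \<union> set I1 \<union> set I2 \<union> set I3 \<and>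
     E \<inter> S \<times> S - {(u, v), (v, u)} =
       list_edges (u # I1 @ [v]) \<union> list_edges (u # I2 @ [v]) \<union> list_edges (u # I3 @ [v])"

definition wheel_on :: "'a rel \<Rightarrow> 'a set \<Rightarrow> 'a list \<Rightarrow> 'a \<Rightarrow> bool" where
  "wheel_on E S w v \<longleftrightarrow> distinct w \<and> 3 \<le> length w \<and> E \<inter> set w \<times> set w = cycle_edges w \<and>
     v \<notin> set w \<and> 3 \<le> card {y \<in> set w. (v, y) \<in> E} \<and> S = insert v (set w)"

lemma theta_on_permute:
  assumes "theta_on E S u v I1 I2 I3"
  shows "theta_on E S u v I2 I1 I3" "theta_on E S u v I1 I3 I2"
proof -
  have "distinct (u # v # I1 @ I2 @ I3)"
    and ne: "I1 \<noteq> []" "I2 \<noteq> []" "I3 \<noteq> []"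
    and S: "S = {u, v} \<union> set I1 \<union> set I2 \<union> set I3"
    and e: "E \<inter> S \<times> S - {(u, v), (v, u)} =
       list_edges (u # I1 @ [v]) \<union> list_edges (u # I2 @ [v]) \<union> list_edges (u # I3 @ [v])"
    using assms unfolding theta_on_def by blast+
  then have d: "distinct (u # v # I2 @ I1 @ I3)" "distinct (u # v # I1 @ I3 @ I2)" by auto
  have S': "S = {u, v} \<union> set I2 \<union> set I1 \<union> set I3" "S = {u, v} \<union> set I1 \<union> set I3 \<union> set I2"
    using S by blast+
  show "theta_on E S u v I2 I1 I3"
    unfolding theta_on_def using d(1) ne S'(1) e
    by (simp only: not_False_eq_True simp_thms Un_commute[of "list_edges (u # I2 @ [v])"])
  show "theta_on E S u v I1 I3 I2"
    unfolding theta_on_def using d(2) ne S'(2) e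
    by (simp only: not_False_eq_True simp_thms Un_ac)
qed

locale ugraph =
  fixes E :: "'a rel"
  assumes E_sym: "(x, y) \<in> E \<Longrightarrow> (y, x) \<in> E"
    and E_irrefl: "(x, x) \<notin> E"
begin

definition no_triangle :: bool where
  "no_triangle \<longleftrightarrow> (\<forall>x y z. (x, y) \<in> E \<longrightarrow> (y, z) \<in> E \<longrightarrow> (x, z) \<notin> E)"

text \<open>The edge equations inside \<open>theta_on\<close> and \<open>wheel_on\<close> make this
  containment as an induced subgraph, with closed thetas included.\<close>

definition contains_theta_or_wheel :: "'a set \<Rightarrow> bool" where
  "contains_theta_or_wheel S \<longleftrightarrow>
     (\<exists>T \<subseteq> S. (\<exists>u v I1 I2 I3. theta_on E T u v I1 I2 I3) \<or> (\<exists>w v. wheel_on E T w v))"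

section \<open>Thetas and closed thetas are minimal 2-connected non-Hamiltonian graphs\<close>

lemma theta_on_two_conn:
  assumes t: "theta_on E S u v I1 I2 I3"
  shows "two_conn E S"
proof -
  let ?c = "u # I1 @ v # rev I2"
  have d: "distinct (u # v # I1 @ I2 @ I3)" and ne: "I1 \<noteq> []" "I2 \<noteq> []"
    and S: "S = {u, v} \<union> set I1 \<union> set I2 \<union> set I3"
    and e: "list_edges (u # I1 @ [v]) \<union> list_edges (u # I2 @ [v]) \<union> list_edges (u # I3 @ [v]) \<subseteq> E"
    using t unfolding theta_on_def by blast+
  \<comment> \<open>Two of the paths form a cycle; the third one is an ear on it.\<close>
  have "two_conn E (set ?c)"
    using d ne e
    by (intro two_conn_cycle) (auto simp only: cycle_edges_two_paths, auto simp: Suc_le_eq)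
  then have "two_conn E (set ?c \<union> set (u # I3 @ [v]))"
    by (rule two_conn_ear) (use d e in auto)
  moreover have "set ?c \<union> set (u # I3 @ [v]) = S" using S by auto
  ultimately show ?thesis by simp
qed

lemma theta_on_interior_edges:
  assumes t: "theta_on E S u v I1 I2 I3" and x: "x \<in> set I1" and y: "y \<in> S"
  shows "(x, y) \<in> E \<longleftrightarrow> (x, y) \<in> list_edges (u # I1 @ [v])"
proof -
  have d: "distinct (u # v # I1 @ I2 @ I3)"
    and S: "S = {u, v} \<union> set I1 \<union> set I2 \<union> set I3"
    and e: "E \<inter> S \<times> S - {(u, v), (v, u)} =
       list_edges (u # I1 @ [v]) \<union> list_edges (u # I2 @ [v]) \<union> list_edges (u # I3 @ [v])"
    using t unfolding theta_on_def by blast+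
  have n: "x \<notin> set (u # I2 @ [v])" "x \<notin> set (u # I3 @ [v])" "x \<noteq> u" "x \<noteq> v" using d x by auto
  have "(x, y) \<in> E \<longleftrightarrow> (x, y) \<in> E \<inter> S \<times> S - {(u, v), (v, u)}"
    using x y S n by auto
  also have "\<dots> \<longleftrightarrow> (x, y) \<in> list_edges (u # I1 @ [v])"
    unfolding e using n list_edges_mem by fast
  finally show ?thesis .
qed

lemma theta_on_interior_neighbours:
  assumes t: "theta_on E S u v I1 I2 I3" and x: "x \<in> set I1"
  obtains a b where "\<And>y. y \<in> S \<Longrightarrow> (x, y) \<in> E \<longleftrightarrow> y = a \<or> y = b"
proof -
  have d: "distinct (u # I1 @ [v])" using t unfolding theta_on_def by auto
  from path_interior_neighbours[OF d x] show ?thesis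
    using that theta_on_interior_edges[OF t x] by metis
qed

lemma theta_on_not_ham:
  assumes t: "theta_on E S u v I1 I2 I3"
  shows "\<not> ham E S"
proof
  assume "ham E S"
  then obtain p where p: "distinct p" "3 \<le> length p" "set p = S" "cycle_edges p \<subseteq> E"
    unfolding ham_def by blast
  \<comment> \<open>The first interior vertex has only two neighbours in \<open>S\<close>, so a
    Hamiltonian cycle uses both of its edges, one of which goes to \<open>u\<close>. The path is
    arbitrary here, since the fact is needed for all three.\<close>
  have forced: "(u, hd J1) \<in> cycle_edges p"
    if t': "theta_on E S u v J1 J2 J3" for J1 J2 J3
  proof -
    have J: "J1 \<noteq> []" and S: "S = {u, v} \<union> set J1 \<union> set J2 \<union> set J3"
      using t' unfolding theta_on_def by blast+
    let ?x = "hd J1"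
    have x: "?x \<in> set J1" using J by simp
    obtain c d where cd: "\<And>y. y \<in> S \<Longrightarrow> (?x, y) \<in> E \<longleftrightarrow> y = c \<or> y = d"
      using theta_on_interior_neighbours[OF t' x] by metis
    have "?x \<in> set p" using x S p(3) by blast
    then obtain a b where ab: "a \<noteq> b" "a \<in> S" "b \<in> S"
        "\<And>y. (?x, y) \<in> cycle_edges p \<longleftrightarrow> y = a \<or> y = b"
      using cycle_degree[OF p(1,2)] p(3) by metis
    have "(?x, u) \<in> list_edges (u # J1 @ [v])" using J by (cases J1) auto
    then have "(?x, u) \<in> E" "u \<in> S" using theta_on_interior_edges[OF t' x] S by auto
    then have "(?x, u) \<in> cycle_edges p" using ab cd p(4) by (metis subsetD)
    then show ?thesis by (simp add: cycle_edges_sym)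
  qed
  have t2: "theta_on E S u v I2 I1 I3" and t3: "theta_on E S u v I3 I1 I2"
    using t theta_on_permute by metis+
  have "u \<in> set p" using t p(3) unfolding theta_on_def by auto
  then obtain a b where "\<And>y. (u, y) \<in> cycle_edges p \<longleftrightarrow> y = a \<or> y = b"
    using cycle_degree[OF p(1,2)] by metis
  then have in_ab: "hd I1 \<in> {a, b}" "hd I2 \<in> {a, b}" "hd I3 \<in> {a, b}"
    using forced[OF t] forced[OF t2] forced[OF t3] by auto
  have "hd I1 \<in> set I1" "hd I2 \<in> set I2" "hd I3 \<in> set I3"
    using t unfolding theta_on_def by auto
  moreover have "set I1 \<inter> set I2 = {}" "set I1 \<inter> set I3 = {}" "set I2 \<inter> set I3 = {}"
    using t unfolding theta_on_def by auto
  ultimately have "hd I1 \<noteq> hd I2" "hd I1 \<noteq> hd I3" "hd I2 \<noteq> hd I3" by (metis disjoint_iff)+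
  with in_ab show False by auto
qed

text \<open>An interior vertex has two neighbours in \<open>S\<close> and needs two in
  \<open>K\<close>, so it draws both into \<open>K\<close>. This spreads along the interior and
  finally reaches the ends.\<close>

lemma theta_on_path_in_two_conn:
  assumes t: "theta_on E S u v I1 I2 I3" and K: "K \<subseteq> S" "two_conn E K" and "set I1 \<inter> K \<noteq> {}"
  shows "insert u (insert v (set I1)) \<subseteq> K"
proof -
  let ?P = "u # I1 @ [v]"
  have ne: "I1 \<noteq> []" and S: "S = {u, v} \<union> set I1 \<union> set I2 \<union> set I3"
    using t unfolding theta_on_def by blast+
  have step: "y \<in> K" if x: "x \<in> set I1" "x \<in> K" and xy: "(x, y) \<in> list_edges ?P" for x y
  proof -
    obtain c d where cd: "\<And>y. y \<in> S \<Longrightarrow> (x, y) \<in> E \<longleftrightarrow> y = c \<or> y = d"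
      using theta_on_interior_neighbours[OF t x(1)] by metis
    obtain a b where "a \<in> K" "b \<in> K" "a \<noteq> b" "(x, a) \<in> E" "(x, b) \<in> E"
      using two_conn_degree[OF K(2) x(2)] by metis
    moreover have "y \<in> S" using list_edges_mem[OF xy] S by auto
    moreover have "(x, y) \<in> E" using theta_on_interior_edges[OF t x(1) \<open>y \<in> S\<close>] xy by simp
    ultimately show ?thesis using cd K(1) by (metis subsetD)
  qed
  have I: "set I1 \<subseteq> K"
  proof (rule ccontr)
    assume "\<not> set I1 \<subseteq> K"
    then have "set I1 \<inter> K \<noteq> set I1" by blast
    with conn_list[OF ne subset_refl] assms(4) obtain a b
      where "a \<in> set I1 \<inter> K" "b \<in> set I1" "b \<notin> set I1 \<inter> K" "(a, b) \<in> list_edges I1"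
      using connD[of "list_edges I1" "set I1" "set I1 \<inter> K"] by (metis inf_le1)
    moreover from this have "(a, b) \<in> list_edges ?P" using ne by (simp add: list_edges_Cons list_edges_snoc)
    ultimately show False using step by blast
  qed
  have "(hd I1, u) \<in> list_edges ?P" "(last I1, v) \<in> list_edges ?P"
    using ne by (simp_all add: list_edges_Cons list_edges_snoc)
  then have "u \<in> K" "v \<in> K" using step I ne by (meson hd_in_set last_in_set subsetD)+
  then show ?thesis using I by simp
qed

lemma theta_on_two_paths_ham:
  assumes t: "theta_on E S u v I1 I2 I3" and K: "K = {u, v} \<union> set I1 \<union> set I2"
  shows "ham E K"
  unfolding ham_def
proof (intro exI conjI)
  let ?c = "u # I1 @ v # rev I2"
  show "distinct ?c" "3 \<le> length ?c" "set ?c = K"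
    using t K unfolding theta_on_def by (auto simp: Suc_le_eq)
  show "cycle_edges ?c \<subseteq> E"
    using t unfolding theta_on_def cycle_edges_two_paths by blast
qed

text \<open>Without the edge \<open>uv\<close> the end \<open>u\<close> would have a single
  neighbour in \<open>K\<close>. So the edge is present and closes the path to a cycle.\<close>

lemma theta_on_one_path_ham:
  assumes t: "theta_on E S u v I1 I2 I3" and K: "two_conn E K" "K = {u, v} \<union> set I1"
  shows "ham E K"
  unfolding ham_def
proof (intro exI conjI)
  let ?P = "u # I1 @ [v]"
  show "distinct ?P" "3 \<le> length ?P" "set ?P = K"
    using t K unfolding theta_on_def by (auto simp: Suc_le_eq)
  have ne: "I1 \<noteq> []" and d: "distinct (u # v # I1 @ I2 @ I3)"
    and S: "S = {u, v} \<union> set I1 \<union> set I2 \<union> set I3"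
    and e: "E \<inter> S \<times> S - {(u, v), (v, u)} =
       list_edges ?P \<union> list_edges (u # I2 @ [v]) \<union> list_edges (u # I3 @ [v])"
    using t unfolding theta_on_def by blast+
  have "(u, v) \<in> E"
  proof (rule ccontr)
    assume "(u, v) \<notin> E"
    have only: "a = hd I1" if "a \<in> K" "(u, a) \<in> E" for a
    proof -
      have a: "a \<in> set I1" using that K(2) \<open>(u, v) \<notin> E\<close> E_irrefl by auto
      then have "(u, a) \<in> list_edges ?P"
        using theta_on_interior_edges[OF t a, of u] E_sym[OF that(2)] S by (simp add: list_edges_sym)
      moreover have "a \<noteq> v" using a d by auto
      ultimately show ?thesis
        using d ne list_edges_mem[of u a "I1 @ [v]"] by (auto simp: list_edges_Cons)
    qed
    have "u \<in> K" using K by simp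
    then show False using two_conn_degree[OF K(1)] only by metis
  qed
  then show "cycle_edges ?P \<subseteq> E"
    using e E_sym by (subst cycle_edges_eq) auto
qed

text \<open>\<open>K\<close> contains both ends, and each interior entirely or not at all. Hence it
  consists of one, two or three of the paths.\<close>

lemma theta_on_minimal:
  assumes t: "theta_on E S u v I1 I2 I3" and K: "K \<subseteq> S" "two_conn E K"
  shows "K = S \<or> ham E K"
proof -
  have S: "S = {u, v} \<union> set I1 \<union> set I2 \<union> set I3" using t unfolding theta_on_def by blast
  have t132: "theta_on E S u v I1 I3 I2" and t213: "theta_on E S u v I2 I1 I3"
    and t231: "theta_on E S u v I2 I3 I1" and t312: "theta_on E S u v I3 I1 I2"
    using t theta_on_permute by metis+
  have dich: "set J1 \<inter> K = {} \<or> {u, v} \<union> set J1 \<subseteq> K" if "theta_on E S u v J1 J2 J3" for J1 J2 J3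
    using theta_on_path_in_two_conn[OF that K] by auto
  \<comment> \<open>A path whose interior meets \<open>K\<close> brings both ends along. If an end
    were missing, no interior would meet \<open>K\<close>, leaving at most two vertices.\<close>
  have "{u, v} \<subseteq> K"
  proof (rule ccontr)
    assume "\<not> {u, v} \<subseteq> K"
    then have "K \<subseteq> {u, v}" using dich[OF t] dich[OF t213] dich[OF t312] K(1) S by blast
    then have "card K \<le> card {u, v}" by (intro card_mono) auto
    also have "\<dots> \<le> 2" by (simp add: card_insert_if)
    finally show False using K(2) by (simp add: two_conn_def)
  qed
  then have "K = {u, v} \<union> (set I1 \<inter> K) \<union> (set I2 \<inter> K) \<union> (set I3 \<inter> K)" using K(1) S by blast
  moreover have "set I1 \<inter> K = {} \<or> set I1 \<inter> K = set I1" using dich[OF t] by blast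
  moreover have "set I2 \<inter> K = {} \<or> set I2 \<inter> K = set I2" using dich[OF t213] by blast
  moreover have "set I3 \<inter> K = {} \<or> set I3 \<inter> K = set I3" using dich[OF t312] by blast
  moreover have "K \<noteq> {u, v}"
  proof
    assume "K = {u, v}"
    then have "card K \<le> 2" by (simp add: card_insert_if)
    then show False using K(2) by (simp add: two_conn_def)
  qed
  ultimately show ?thesis
    using theta_on_one_path_ham[OF t K(2)] theta_on_one_path_ham[OF t213 K(2)]
      theta_on_one_path_ham[OF t312 K(2)] theta_on_two_paths_ham[OF t]
      theta_on_two_paths_ham[OF t132] theta_on_two_paths_ham[OF t231] S
    by (metis Un_empty_right)
qed

section \<open>Triangle-free wheels are minimal 2-connected non-Hamiltonian graphs\<close>

lemma wheel_on_two_conn: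
  assumes w: "wheel_on E S w v"
  shows "two_conn E S"
proof -
  let ?N = "{y \<in> set w. (v, y) \<in> E}"
  have "3 \<le> card ?N" using w unfolding wheel_on_def by blast
  then have "?N \<noteq> {}" "?N \<noteq> {a}" for a by force+
  then obtain a b where ab: "a \<in> ?N" "b \<in> ?N" "a \<noteq> b" by blast
  have "two_conn E (set w)" using w unfolding wheel_on_def by (intro two_conn_cycle) auto
  \<comment> \<open>The hub with two of its spokes is an ear on the rim.\<close>
  then have "two_conn E (set w \<union> set [a, v, b])"
    by (rule two_conn_ear) (use ab w E_sym in \<open>auto simp: wheel_on_def\<close>)
  moreover have "set w \<union> set [a, v, b] = S" using ab w by (auto simp: wheel_on_def)
  ultimately show ?thesis by simp
qed

text \<open>Consider the cycle neighbour \<open>c\<close> of \<open>q ! 0\<close> other than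
  \<open>q ! 1\<close>. If \<open>c\<close> were not the last vertex of \<open>q\<close>, it would
  have three neighbours on the cycle: \<open>q ! 0\<close>, its predecessor and its successor in
  \<open>q\<close>. Applied to a Hamiltonian cycle of a wheel with the hub removed, this makes the
  two neighbours of the hub on that cycle adjacent.\<close>

lemma cycle_hamiltonian_path_closes:
  assumes w: "distinct w" "3 \<le> length w"
    and q: "distinct q" "set q = set w" "list_edges q \<subseteq> cycle_edges w"
  shows "(hd q, last q) \<in> cycle_edges w"
proof (rule ccontr)
  assume no: "(hd q, last q) \<notin> cycle_edges w"
  have len: "length q = length w" using w q by (metis distinct_card)
  then have l3: "3 \<le> length q" using w by simp
  then have "q \<noteq> []" by auto
  then have h: "hd q = q ! 0" "last q = q ! (length q - 1)" by (auto simp: hd_conv_nth last_conv_nth)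
  have edge: "(q ! i, q ! Suc i) \<in> cycle_edges w" if "Suc i < length q" for i
    using that q(3) list_edges_nth[of "q ! i" "q ! Suc i" q] by blast
  have "q ! 0 \<in> set w" using l3 q(2) by (cases q) auto
  then obtain a b where ab: "a \<noteq> b" "a \<in> set w" "b \<in> set w" "a \<noteq> q ! 0" "b \<noteq> q ! 0"
      "\<And>y. (q ! 0, y) \<in> cycle_edges w \<longleftrightarrow> y = a \<or> y = b"
    using cycle_degree[OF w] by blast
  obtain c where c: "c \<in> set w" "c \<noteq> q ! 0" "c \<noteq> q ! 1" "(q ! 0, c) \<in> cycle_edges w"
    using ab by (cases "a = q ! 1") auto
  obtain k where k: "k < length q" "c = q ! k" using c(1) q(2) by (metis in_set_conv_nth)
  have "k \<noteq> 0" "k \<noteq> 1" "k \<noteq> length q - 1" using c(2-4) k(2) no h by metis+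
  \<comment> \<open>The lower bound 2 makes the predecessor of \<open>c\<close> differ from
    \<open>q ! 0\<close>; the upper bound provides a successor.\<close>
  then have kk: "2 \<le> k" "Suc k < length q" using k by auto
  obtain d e where de: "\<And>y. (c, y) \<in> cycle_edges w \<longleftrightarrow> y = d \<or> y = e"
    using cycle_degree[OF w c(1)] by metis
  have "(c, q ! 0) \<in> cycle_edges w" using c(4) cycle_edges_sym by metis
  moreover have "(c, q ! Suc k) \<in> cycle_edges w" using edge[of k] kk k by simp
  moreover have "(c, q ! (k - 1)) \<in> cycle_edges w"
    using edge[of "k - 1"] kk k cycle_edges_sym by (metis Suc_diff_1 less_le_trans pos2 Suc_lessD)
  ultimately have "q ! 0 \<in> {d, e}" "q ! Suc k \<in> {d, e}" "q ! (k - 1) \<in> {d, e}"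
    by (simp_all only: de insert_iff empty_iff simp_thms)
  moreover have "q ! 0 \<noteq> q ! Suc k" "q ! 0 \<noteq> q ! (k - 1)" "q ! Suc k \<noteq> q ! (k - 1)"
    using kk nth_eq_iff_index_eq[OF q(1), of 0 "Suc k"] nth_eq_iff_index_eq[OF q(1), of 0 "k - 1"]
      nth_eq_iff_index_eq[OF q(1), of "Suc k" "k - 1"] by linarith+
  ultimately show False by auto
qed

lemma wheel_on_not_ham:
  assumes w: "wheel_on E S w v" and tf: no_triangle
  shows "\<not> ham E S"
proof
  assume "ham E S"
  then obtain p where p: "distinct p" "3 \<le> length p" "set p = S" "cycle_edges p \<subseteq> E"
    unfolding ham_def by blast
  have dw: "distinct w" "3 \<le> length w" "E \<inter> set w \<times> set w = cycle_edges w" "v \<notin> set w"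
    and S: "S = insert v (set w)" using w unfolding wheel_on_def by auto
  have "v \<in> set p" using p(3) S by simp
  then obtain q where q: "distinct (v # q)" "set (v # q) = set p"
      "cycle_edges (v # q) = cycle_edges p" "length (v # q) = length p"
    using cycle_rotate_to p(1) by metis
  have ne: "q \<noteq> []" using q(4) p(2) by auto
  have e: "cycle_edges (v # q) = {(v, hd q), (hd q, v), (v, last q), (last q, v)} \<union> list_edges q"
    using ne by (auto simp: list_edges_Cons list_edges_snoc)
  have sq: "set q = set w" using q p(3) S dw(4) by auto
  have "list_edges q \<subseteq> E" "(v, hd q) \<in> E" "(last q, v) \<in> E" using e q(3) p(4) by auto
  moreover from this have "list_edges q \<subseteq> cycle_edges w"
    using dw(3) sq list_edges_subset[of q] by auto
  then have "(hd q, last q) \<in> cycle_edges w"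
    using cycle_hamiltonian_path_closes dw sq q(1) by (metis distinct.simps(2))
  then have "(hd q, last q) \<in> E" using dw(3) by blast
  ultimately show False using tf E_sym unfolding no_triangle_def by blast
qed

text \<open>Connected subsets of an induced path are intervals. \<open>M\<close> is the first
  maximal run of vertices in \<open>L\<close>; an edge from it to a later vertex can only lead to
  \<open>hd B\<close>, which is not in \<open>L\<close>.\<close>

lemma conn_subset_path_segment:
  assumes q: "distinct q" "E \<inter> set q \<times> set q = list_edges q" and L: "L \<subseteq> set q" "conn E L"
  obtains A M B where "q = A @ M @ B" "set M = L"
proof -
  define A where "A = takeWhile (\<lambda>x. x \<notin> L) q"
  define R where "R = dropWhile (\<lambda>x. x \<notin> L) q"
  define M where "M = takeWhile (\<lambda>x. x \<in> L) R"
  define B where "B = dropWhile (\<lambda>x. x \<in> L) R"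
  have eq: "q = A @ M @ B" unfolding A_def M_def B_def R_def by simp
  have A: "set A \<inter> L = {}" and subL: "set M \<subseteq> L"
    unfolding A_def M_def by (auto dest: set_takeWhileD)
  have "L \<noteq> {}" using L by (simp add: conn_def)
  then have "\<exists>x\<in>set q. x \<in> L" using L(1) by blast
  then have "R \<noteq> []" "hd R \<in> L" unfolding R_def
    by (auto simp: dropWhile_eq_Nil_conv) (metis (mono_tags, lifting) dropWhile_eq_Nil_conv hd_dropWhile)
  then have Mne: "M \<noteq> []" unfolding M_def by (cases R) auto
  have "set M = L"
  proof (rule ccontr)
    assume "set M \<noteq> L"
    with L(2) subL Mne obtain a b where ab: "a \<in> set M" "b \<in> L" "b \<notin> set M" "(a, b) \<in> E"
      using connD[of E L "set M"] by (metis set_empty)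
    have b: "b \<in> set B" using ab L(1) A eq by auto
    then have Bne: "B \<noteq> []" by auto
    then have "hd B \<notin> L" unfolding B_def using hd_dropWhile by metis
    then have bh: "b \<noteq> hd B" using ab(2) by blast
    have "a \<in> set q" "b \<in> set q" using eq ab b by auto
    then have "(a, b) \<in> list_edges q" using q(2) ab(4) by blast
    moreover have "list_edges q = list_edges ((A @ M) @ B)" using eq by simp
    ultimately have "(a, b) \<in> list_edges (A @ M) \<or> (a, b) \<in> list_edges B \<or>
        (a, b) = (last M, hd B) \<or> (a, b) = (hd B, last M)"
      using Mne Bne by (subst (asm) list_edges_append) auto
    moreover have "b \<notin> set (A @ M)" "a \<notin> set B" using q(1) ab b eq by auto
    ultimately show False using bh Bne list_edges_mem[of a b] by (metis hd_in_set prod.inject)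
  qed
  then show ?thesis using that eq by blast
qed

text \<open>Without the hub, \<open>K\<close> must be the whole rim. With the hub and a rim vertex
  missing, the rest of \<open>K\<close> is a segment of the rim, and the hub closes it to a
  cycle.\<close>

lemma wheel_on_minimal:
  assumes w: "wheel_on E S w v" and K: "K \<subseteq> S" "two_conn E K"
  shows "K = S \<or> ham E K"
proof -
  have dw: "distinct w" "3 \<le> length w" "E \<inter> set w \<times> set w = cycle_edges w" "v \<notin> set w"
    and S: "S = insert v (set w)" using w unfolding wheel_on_def by auto
  consider "K = S" | "v \<notin> K" | "v \<in> K" "\<not> set w \<subseteq> K" using K(1) S by blast
  then show ?thesis
  proof cases
    case 2
    have Kw: "K \<subseteq> set w" using 2 K(1) S by auto
    \<comment> \<open>Otherwise some vertex of \<open>K\<close> has a rim neighbour outside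
      \<open>K\<close>, which leaves it at most one neighbour in \<open>K\<close>.\<close>
    have "K = set w"
    proof (rule ccontr)
      assume "K \<noteq> set w"
      moreover have "K \<noteq> {}" using K(2) by (auto simp: two_conn_def)
      moreover have "conn (cycle_edges w) (set w)"
        using two_conn_cycle[OF dw(1,2) subset_refl] by (simp add: two_conn_def)
      ultimately obtain a b where ab: "a \<in> K" "b \<in> set w" "b \<notin> K" "(a, b) \<in> cycle_edges w"
        using connD Kw by metis
      obtain c d where "c \<in> K" "d \<in> K" "c \<noteq> d" "(a, c) \<in> E" "(a, d) \<in> E"
        using two_conn_degree[OF K(2) ab(1)] by metis
      moreover from this have "(a, c) \<in> cycle_edges w" "(a, d) \<in> cycle_edges w"
        using dw(3) ab(1) Kw by auto
      moreover have "a \<in> set w" using ab(1) Kw by blast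
      ultimately show False using cycle_degree[OF dw(1,2)] ab by metis
    qed
    then have "ham E K" unfolding ham_def using dw by blast
    then show ?thesis ..
  next
    case 3
    then obtain r where r: "r \<in> set w" "r \<notin> K" by blast
    \<comment> \<open>Opened at the missing vertex \<open>r\<close>, the rim becomes an induced path
      that contains \<open>K - {v}\<close>.\<close>
    obtain q where q: "distinct (r # q)" "set (r # q) = set w"
      "cycle_edges (r # q) = cycle_edges w" "length (r # q) = length w"
      using cycle_rotate_to r(1) dw(1) by metis
    have ne: "q \<noteq> []" using q(4) dw(2) by auto
    have "E \<inter> set q \<times> set q = cycle_edges (r # q) \<inter> set q \<times> set q"
      unfolding q(3) dw(3)[symmetric] using q(2) by auto
    also have "\<dots> = list_edges q"
      using q(1) ne list_edges_subset[of q] by (auto simp: list_edges_Cons list_edges_snoc)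
    finally have eq: "E \<inter> set q \<times> set q = list_edges q" .
    have L: "K - {v} \<subseteq> set q" using K(1) S q(2) r by auto
    have "conn E (K - {v})" using K(2) 3 by (simp add: two_conn_def)
    then obtain A M B where M: "q = A @ M @ B" "set M = K - {v}"
      using conn_subset_path_segment[OF _ eq L] q(1) by (metis distinct.simps(2))
    have eM: "E \<inter> set M \<times> set M = list_edges M"
    proof -
      have d: "distinct (A @ M @ B)" using q(1) M(1) by simp
      then have "list_edges M = list_edges (M @ B) \<inter> set M \<times> set M"
        by (simp add: list_edges_append_Int)
      also have "\<dots> = list_edges (A @ M @ B) \<inter> set (M @ B) \<times> set (M @ B) \<inter> set M \<times> set M"
        using d by (simp only: list_edges_append_Int)
      also have "\<dots> = E \<inter> set M \<times> set M" using eq M(1) by auto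
      finally show ?thesis by simp
    qed
    have dM: "distinct M" using q(1) M(1) by simp
    have "card K = Suc (card (set M))"
      using M(2) 3 K(2) by (metis List.finite_set card_Suc_Diff1 finite_Diff2 finite.emptyI finite_insert)
    then have len: "2 \<le> length M" using K(2) dM by (simp add: two_conn_def distinct_card)
    \<comment> \<open>An end of the segment has one neighbour inside it, so its second neighbour in
      \<open>K\<close> is the hub. Stated for a list \<open>N\<close> to cover \<open>M\<close> and
      its reversal, that is, both ends.\<close>
    have hub: "(v, hd N) \<in> E"
      if N: "distinct N" "2 \<le> length N" "set N = K - {v}" "E \<inter> set N \<times> set N = list_edges N" for N
    proof -
      obtain x N' where N': "N = x # N'" "N' \<noteq> []" using N(2) by (cases N; cases "tl N") auto
      have x: "x \<in> K" using N(3) N' by auto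
      have "y = v \<or> y = hd N'" if "y \<in> K" "(x, y) \<in> E" for y
      proof (cases "y = v")
        case False
        then have "(x, y) \<in> list_edges N" using that N N' by auto
        then show ?thesis using N(1) N' list_edges_mem[of x y N'] by (auto simp: list_edges_Cons)
      qed simp
      then have "(x, v) \<in> E" using two_conn_degree[OF K(2) x] by metis
      then show ?thesis using N' E_sym by simp
    qed
    have "(v, hd M) \<in> E" using hub[of M] dM len M(2) eM by simp
    moreover have "(v, last M) \<in> E"
      using hub[of "rev M"] dM len M(2) eM by (simp add: hd_rev)
    ultimately have "cycle_edges (v # M) \<subseteq> E"
      using eM E_sym len by (cases "M = []") (auto simp: list_edges_Cons list_edges_snoc)
    moreover have "set (v # M) = K" "distinct (v # M)" "3 \<le> length (v # M)"
      using M(2) 3 dM len by auto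
    ultimately show ?thesis unfolding ham_def by blast
  qed simp
qed

lemma contains_theta: "theta_on E S u v I1 I2 I3 \<Longrightarrow> contains_theta_or_wheel S"
  unfolding contains_theta_or_wheel_def by (intro exI[of _ S]) auto

lemma contains_wheel: "wheel_on E S w v \<Longrightarrow> contains_theta_or_wheel S"
  unfolding contains_theta_or_wheel_def by (intro exI[of _ S]) auto

lemma contains_mono: "contains_theta_or_wheel S \<Longrightarrow> S \<subseteq> T \<Longrightarrow> contains_theta_or_wheel T"
  unfolding contains_theta_or_wheel_def by (meson order_trans)

subsection \<open>Induced paths and cycles\<close>

lemma component:
  assumes "finite T" "x \<in> T"
  obtains K where "x \<in> K" "K \<subseteq> T" "conn E K" "\<And>a b. a \<in> K \<Longrightarrow> b \<in> T - K \<Longrightarrow> (a, b) \<notin> E"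
proof -
  let ?P = "\<lambda>K. x \<in> K \<and> K \<subseteq> T \<and> conn E K"
  have "?P {x}" using assms by (simp add: conn_singleton)
  moreover have "\<forall>K. ?P K \<longrightarrow> card K \<le> card T" using assms(1) by (auto intro: card_mono)
  ultimately obtain K where K: "?P K" and max: "\<And>L. ?P L \<Longrightarrow> card L \<le> card K"
    using ex_has_greatest_nat[of ?P "{x}" card "Suc (card T)"] by (auto simp: less_Suc_eq_le)
  have "(a, b) \<notin> E" if "a \<in> K" "b \<in> T - K" for a b
  proof
    assume "(a, b) \<in> E"
    then have "?P (insert b K)" using that K E_sym by (auto intro: conn_insert)
    then have "card (insert b K) \<le> card K" by (rule max)
    moreover have "finite K" using K assms(1) finite_subset by blast
    ultimately show False using that by simp
  qed
  then show ?thesis using that K by blast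
qed

lemma conn_walk:
  assumes "conn E K" "a \<in> K" "b \<in> K"
  obtains p where "p \<noteq> []" "set p \<subseteq> K" "list_edges p \<subseteq> E" "hd p = a" "last p = b"
proof -
  let ?W = "\<lambda>y p. p \<noteq> [] \<and> set p \<subseteq> K \<and> list_edges p \<subseteq> E \<and> hd p = a \<and> last p = y"
  let ?R = "{y \<in> K. \<exists>p. ?W y p}"
  have "?W a [a]" using assms by simp
  then have "a \<in> ?R" using assms(2) by blast
  have "?R = K"
  proof (rule ccontr)
    assume "?R \<noteq> K"
    then obtain y z where yz: "y \<in> ?R" "z \<in> K" "z \<notin> ?R" "(y, z) \<in> E"
      using connD[OF assms(1), of ?R] \<open>a \<in> ?R\<close> by blast
    then obtain p where "?W y p" by blast
    then have "?W z (p @ [z])" using yz E_sym by (simp add: list_edges_snoc)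
    then show False using yz by blast
  qed
  then show ?thesis using assms(3) that by blast
qed

text \<open>A shortest walk among all walks in \<open>K\<close> whose first and last vertex are
  related by \<open>Q\<close>. Shortcuts exclude repetitions and chords; subwalks yield the last two
  conclusions. Those respect the order along the path, because \<open>Q\<close> need not be
  symmetric, and the case of a single vertex is separate.\<close>

lemma shortest_path:
  assumes K: "conn E K" "a \<in> K" "b \<in> K" and Q: "Q a b"
  obtains p where "p \<noteq> []" "set p \<subseteq> K" "distinct p" "E \<inter> set p \<times> set p = list_edges p"
    "Q (hd p) (last p)"
    "\<And>A x B. p = A @ x # B \<Longrightarrow> Q x x \<Longrightarrow> A = [] \<and> B = []"
    "\<And>A x B y C. p = A @ x # B @ y # C \<Longrightarrow> Q x y \<Longrightarrow> A = [] \<and> C = []"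
proof -
  let ?P = "\<lambda>p. p \<noteq> [] \<and> set p \<subseteq> K \<and> list_edges p \<subseteq> E \<and> Q (hd p) (last p)"
  obtain p0 where "?P p0" using conn_walk[OF K] Q by metis
  then obtain p where p: "?P p" and min: "\<And>q. ?P q \<Longrightarrow> length p \<le> length q"
    using ex_has_least_nat[of ?P p0 length] by blast
  have dist: "distinct p"
  proof (rule ccontr)
    assume "\<not> distinct p"
    then obtain A x B C where eq: "p = A @ x # B @ x # C" using not_distinct_decomp by fastforce
    have "list_edges (A @ x # C) \<subseteq> list_edges p"
      unfolding eq list_edges_split[of A x "B @ x # C"] list_edges_split[of A x C]
      using list_edges_append_subset(2)[of "x # C" "x # B"] by auto
    then have "?P (A @ x # C)" using p by (cases A) (auto simp: eq)
    from min[OF this] show False by (simp add: eq)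
  qed
  have chord: "B = []" if eq: "p = A @ x # B @ y # C" and xy: "(x, y) \<in> E" for A x B y C
  proof -
    have "list_edges (A @ [x]) \<subseteq> E" "list_edges (y # C) \<subseteq> E"
      using p list_edges_append_subset(1)[of "A @ [x]" "B @ y # C"]
        list_edges_append_subset(2)[of "y # C" "A @ x # B"] by (auto simp: eq)
    then have "list_edges (A @ x # y # C) \<subseteq> E"
      using xy E_sym[OF xy] by (auto simp: list_edges_split[of A x "y # C"])
    then have "?P (A @ x # y # C)" using p by (cases A) (auto simp: eq)
    from min[OF this] show ?thesis by (simp add: eq)
  qed
  have ind: "E \<inter> set p \<times> set p = list_edges p"
  proof (intro equalityI subsetI)
    fix e assume e: "e \<in> E \<inter> set p \<times> set p"
    obtain x y where xy: "e = (x, y)" by (cases e)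
    have xy': "x \<in> set p" "y \<in> set p" "(x, y) \<in> E" "(y, x) \<in> E" "x \<noteq> y"
      using e by (auto simp: xy E_irrefl intro: E_sym)
    then obtain A B where eq: "p = A @ x # B" using split_list by metis
    consider "y \<in> set A" | "y \<in> set B" using xy' eq by auto
    then have "(x, y) \<in> list_edges p"
    proof cases
      case 1
      then obtain A1 A2 where "A = A1 @ y # A2" using split_list by metis
      then have eq': "p = A1 @ y # A2 @ x # B" using eq by simp
      then have "A2 = []" using chord xy'(4) by metis
      then show ?thesis using eq' list_edges_append_subset(2)[of "y # x # B" A1] by auto
    next
      case 2
      then obtain B1 B2 where "B = B1 @ y # B2" using split_list by metis
      then have eq': "p = A @ x # B1 @ y # B2" using eq by simp
      then have "B1 = []" using chord xy'(3) by metis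
      then show ?thesis using eq' list_edges_append_subset(2)[of "x # y # B2" A] by auto
    qed
    then show "e \<in> list_edges p" by (simp add: xy)
  next
    fix e assume "e \<in> list_edges p"
    then show "e \<in> E \<inter> set p \<times> set p" using p list_edges_subset[of p] by blast
  qed
  show ?thesis
  proof (rule that)
    fix A x B assume eq: "p = A @ x # B" and "Q x x"
    then have "?P [x]" using p by simp
    from min[OF this] show "A = [] \<and> B = []" by (simp add: eq)
  next
    fix A x B y C assume eq: "p = A @ x # B @ y # C" and "Q x y"
    moreover have "list_edges (x # B @ [y]) \<subseteq> E"
      using p list_edges_append_subset(1)[of "x # B @ [y]" C]
        list_edges_append_subset(2)[of "x # B @ y # C" A] by (auto simp: eq)
    ultimately have "?P (x # B @ [y])" using p by simp
    from min[OF this] show "A = [] \<and> C = []" by (simp add: eq)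
  qed (use p dist ind in auto)
qed

text \<open>A shortest path avoiding \<open>x\<close> between two neighbours of \<open>x\<close>
  closes through \<open>x\<close> to a chordless cycle.\<close>

lemma induced_cycle_exists:
  assumes S: "two_conn E S"
  obtains w where "distinct w" "3 \<le> length w" "set w \<subseteq> S" "E \<inter> set w \<times> set w = cycle_edges w"
proof -
  have "S \<noteq> {}" using S by (auto simp: two_conn_def)
  then obtain x where x: "x \<in> S" by blast
  obtain a b where ab: "a \<in> S" "b \<in> S" "a \<noteq> b" "a \<noteq> x" "b \<noteq> x" "(x, a) \<in> E" "(x, b) \<in> E"
    using two_conn_degree[OF S x] .
  \<comment> \<open>Requiring distinct ends keeps the path from shrinking to a single
    vertex.\<close>
  define Q where "Q = (\<lambda>a b. a \<noteq> b \<and> (x, a) \<in> E \<and> (x, b) \<in> E)"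
  have "conn E (S - {x})" using S x by (simp add: two_conn_def)
  moreover have "a \<in> S - {x}" "b \<in> S - {x}" "Q a b" using ab by (auto simp: Q_def)
  ultimately obtain p where p: "p \<noteq> []" "set p \<subseteq> S - {x}" "distinct p"
      "E \<inter> set p \<times> set p = list_edges p" "Q (hd p) (last p)"
      "\<And>A x B. p = A @ x # B \<Longrightarrow> Q x x \<Longrightarrow> A = [] \<and> B = []"
      and min: "\<And>A x B y C. p = A @ x # B @ y # C \<Longrightarrow> Q x y \<Longrightarrow> A = [] \<and> C = []"
    using shortest_path[of "S - {x}" a b Q] by blast
  obtain y p' where p': "p = y # p'" "p' \<noteq> []" using p(1,5) unfolding Q_def by (cases p) fastforce+
  \<comment> \<open>A further neighbour of \<open>x\<close> would form a pair with the first vertex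
    \<open>y\<close>, and the path could stop there.\<close>
  have nb: "z = hd p \<or> z = last p" if z: "z \<in> set p" "(x, z) \<in> E" for z
  proof (cases "z = y")
    case False
    then have "z \<in> set p'" using z p' by simp
    then obtain B C where BC: "p' = B @ z # C" using split_list by metis
    have "Q y z" using z False p(5) p' by (simp add: Q_def)
    then have "C = []" using min[of "[]" y B z C] p' BC by simp
    then show ?thesis using p' BC by simp
  qed (simp add: p')
  have h: "(x, hd p) \<in> E" "(x, last p) \<in> E" "hd p \<in> set p" "last p \<in> set p"
    using p by (auto simp: Q_def)
  have "E \<inter> set (x # p) \<times> set (x # p) =
      E \<inter> set p \<times> set p \<union> {(x, hd p), (hd p, x), (x, last p), (last p, x)}"
    using nb h by (auto simp: E_irrefl intro: E_sym dest: E_sym)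
  then have "E \<inter> set (x # p) \<times> set (x # p) = cycle_edges (x # p)"
    using p(1,4) by (auto simp: list_edges_Cons list_edges_snoc)
  then show ?thesis
    using that[of "x # p"] p(2,3) x p' by (auto simp: Suc_le_eq)
qed

subsection \<open>Attaching a path to an induced cycle\<close>

text \<open>The attachments \<open>a\<close> and \<open>b\<close> become the ends, with the two arcs
  of \<open>w\<close> and the ear as paths. Non-adjacency of \<open>a\<close> and \<open>b\<close>
  gives both arcs a nonempty interior.\<close>

lemma theta_from_ear:
  assumes w: "distinct w" "3 \<le> length w" "E \<inter> set w \<times> set w = cycle_edges w"
    and p: "p \<noteq> []" "distinct p" "set p \<inter> set w = {}" "E \<inter> set p \<times> set p = list_edges p"
    and ab: "a \<in> set w" "b \<in> set w" "a \<noteq> b" "(a, b) \<notin> E" "(hd p, a) \<in> E" "(last p, b) \<in> E"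
    and only: "\<And>x c. x \<in> set p \<Longrightarrow> c \<in> set w \<Longrightarrow> (x, c) \<in> E \<Longrightarrow>
      x = hd p \<and> c = a \<or> x = last p \<and> c = b"
  shows "contains_theta_or_wheel (set w \<union> set p)"
proof -
  obtain q where q: "distinct (a # q)" "set (a # q) = set w" "cycle_edges (a # q) = cycle_edges w"
    "length (a # q) = length w"
    using cycle_rotate_to ab(1) w(1) by metis
  then have "b \<in> set q" using ab by auto
  then obtain I J where IJ: "q = I @ b # J" using split_list by metis
  have ce: "cycle_edges w = list_edges (a # I @ [b]) \<union> list_edges (a # rev J @ [b])"
    using cycle_edges_two_paths[of a I b "rev J"] q(3) IJ by simp
  have "(a, b) \<notin> cycle_edges w" using ab w(3) by blast
  then have ne: "I \<noteq> []" "J \<noteq> []" unfolding ce by auto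
  let ?S = "set w \<union> set p"
  have h: "hd p \<in> set p" "last p \<in> set p" using p(1) by auto
  have nb: "(b, a) \<notin> E" using ab(4) E_sym by blast
  have "E \<inter> ?S \<times> ?S - {(a, b), (b, a)} =
      E \<inter> set w \<times> set w \<union> E \<inter> set p \<times> set p \<union> {(a, hd p), (hd p, a), (last p, b), (b, last p)}"
  proof (intro equalityI subrelI)
    fix x y assume "(x, y) \<in> E \<inter> ?S \<times> ?S - {(a, b), (b, a)}"
    then have xy: "(x, y) \<in> E" "(y, x) \<in> E" "x \<in> ?S" "y \<in> ?S" by (auto intro: E_sym)
    then show "(x, y) \<in> E \<inter> set w \<times> set w \<union> E \<inter> set p \<times> set p \<union>
        {(a, hd p), (hd p, a), (last p, b), (b, last p)}"
      using only[of x y] only[of y x] by blast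
  next
    fix x y assume "(x, y) \<in> E \<inter> set w \<times> set w \<union> E \<inter> set p \<times> set p \<union>
        {(a, hd p), (hd p, a), (last p, b), (b, last p)}"
    then show "(x, y) \<in> E \<inter> ?S \<times> ?S - {(a, b), (b, a)}"
      using ab h E_sym nb by blast
  qed
  also have "\<dots> = list_edges (a # I @ [b]) \<union> list_edges (a # rev J @ [b]) \<union> list_edges (a # p @ [b])"
    unfolding w(3) p(4) ce using p(1) by (auto simp: list_edges_Cons list_edges_snoc)
  finally have e: "E \<inter> ?S \<times> ?S - {(a, b), (b, a)} =
      list_edges (a # I @ [b]) \<union> list_edges (a # rev J @ [b]) \<union> list_edges (a # p @ [b])" .
  have "distinct (a # b # I @ rev J @ p)" using q(1,2) p(2,3) IJ by auto
  moreover have "?S = {a, b} \<union> set I \<union> set (rev J) \<union> set p" using q(2) IJ by auto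
  ultimately have "theta_on E ?S a b I (rev J) p"
    unfolding theta_on_def using ne p(1) e by (metis rev_is_Nil_conv)
  then show ?thesis by (rule contains_theta)
qed

text \<open>Here \<open>c\<close> lies between \<open>a\<close> and \<open>b\<close> on
  \<open>w\<close>. Replacing it by the ear gives a new induced cycle, on which \<open>c\<close>
  sees \<open>a\<close>, \<open>b\<close> and \<open>x\<close>; so \<open>c\<close> becomes the hub,
  and any number of edges from the ear to \<open>c\<close> are just further spokes.\<close>

lemma wheel_from_ear:
  assumes w: "distinct w" "3 \<le> length w" "E \<inter> set w \<times> set w = cycle_edges w"
    and p: "p \<noteq> []" "distinct p" "set p \<inter> set w = {}" "E \<inter> set p \<times> set p = list_edges p"
    and ab: "a \<in> set w" "b \<in> set w" "a \<noteq> b" "(hd p, a) \<in> E" "(last p, b) \<in> E"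
    and c: "c \<in> set w" "(c, a) \<in> E" "(c, b) \<in> E" "x \<in> set p" "(x, c) \<in> E"
    and only: "\<And>x d. x \<in> set p \<Longrightarrow> d \<in> set w \<Longrightarrow> (x, d) \<in> E \<Longrightarrow>
      x = hd p \<and> d = a \<or> x = last p \<and> d = b \<or> d = c"
  shows "contains_theta_or_wheel (set w \<union> set p)"
proof -
  have cw: "(c, a) \<in> cycle_edges w" "(c, b) \<in> cycle_edges w" using c ab w(3) by auto
  \<comment> \<open>Opened at the edge \<open>cb\<close>, the cycle reads \<open>c\<close>,
    \<open>a\<close>, ..., \<open>b\<close>; dropping \<open>c\<close> leaves an induced path from
    \<open>a\<close> to \<open>b\<close>.\<close>
  obtain p' where p': "distinct p'" "set p' = set w" "length p' = length w" "hd p' = c" "last p' = b"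
    "cycle_edges p' = cycle_edges w"
    using cycle_open_at_edge[OF w(1,2) cw(2)] .
  then obtain q where q: "p' = c # q" using w(2) by (cases p') auto
  have dq: "distinct (c # q)" "3 \<le> length (c # q)" using p' q w(2) by auto
  then have ne: "q \<noteq> []" by auto
  then have lq: "last q = b" using p'(5) q by simp
  then have hq: "hd q = a" using cycle_edges_neighbours_hd[OF dq] cw p'(6) q ab(3) by auto
  have sw: "set w = insert c (set q)" "c \<notin> set q" using p'(2) q dq by auto
  have eq: "E \<inter> set q \<times> set q = list_edges q"
  proof -
    have "E \<inter> set q \<times> set q = cycle_edges (c # q) \<inter> set q \<times> set q"
      using w(3) p'(6) q sw by auto
    also have "\<dots> = list_edges q"
      using sw(2) ne list_edges_subset[of q] by (auto simp: list_edges_Cons list_edges_snoc)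
    finally show ?thesis .
  qed
  let ?w = "q @ rev p"
  have h: "hd p \<in> set p" "last p \<in> set p" "a \<in> set q" "b \<in> set q" using p(1) ne lq hq by auto
  have "E \<inter> set ?w \<times> set ?w = E \<inter> set q \<times> set q \<union> E \<inter> set p \<times> set p \<union>
      {(a, hd p), (hd p, a), (last p, b), (b, last p)}"
  proof (intro equalityI subrelI)
    fix y z assume "(y, z) \<in> E \<inter> set ?w \<times> set ?w"
    then have yz: "(y, z) \<in> E" "(z, y) \<in> E" "y \<in> set q \<union> set p" "z \<in> set q \<union> set p"
      by (auto intro: E_sym)
    then show "(y, z) \<in> E \<inter> set q \<times> set q \<union> E \<inter> set p \<times> set p \<union>
        {(a, hd p), (hd p, a), (last p, b), (b, last p)}"
      using only[of y z] only[of z y] sw by blast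
  next
    fix y z assume "(y, z) \<in> E \<inter> set q \<times> set q \<union> E \<inter> set p \<times> set p \<union>
        {(a, hd p), (hd p, a), (last p, b), (b, last p)}"
    then show "(y, z) \<in> E \<inter> set ?w \<times> set ?w" using ab h by (auto intro: E_sym)
  qed
  also have "\<dots> = cycle_edges ?w"
    unfolding eq p(4) using ne p(1) hq lq
    by (auto simp: cycle_edges_eq list_edges_append hd_rev last_rev)
  finally have e: "E \<inter> set ?w \<times> set ?w = cycle_edges ?w" .
  have "a \<noteq> x" "b \<noteq> x" using ab c p(3) by auto
  then have "card {a, b, x} = 3" using ab(3) by simp
  moreover have "{a, b, x} \<subseteq> {y \<in> set ?w. (c, y) \<in> E}" using h c by (auto intro: E_sym)
  ultimately have "3 \<le> card {y \<in> set ?w. (c, y) \<in> E}"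
    using card_mono[of "{y \<in> set ?w. (c, y) \<in> E}" "{a, b, x}"] by simp
  moreover have "distinct ?w" using dq p(2,3) sw by auto
  moreover have "3 \<le> length ?w" using dq(2) p(1) by (cases p) auto
  moreover have "c \<notin> set ?w" using sw p(3) by auto
  ultimately have "wheel_on E (insert c (set ?w)) ?w c" unfolding wheel_on_def using e by blast
  moreover have "insert c (set ?w) = set w \<union> set p" using sw by auto
  ultimately show ?thesis using contains_wheel by metis
qed

text \<open>Take a shortest path in \<open>K\<close> whose ends attach to non-adjacent vertices
  \<open>a\<close>, \<open>b\<close> of \<open>w\<close>. Without other edges to \<open>w\<close> it
  gives a theta. Otherwise a one-vertex path is the hub of a wheel with rim \<open>w\<close>; for a
  longer path all extra edges go to one common neighbour of \<open>a\<close> and \<open>b\<close>,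
  which is the hub of the rerouted wheel.\<close>

lemma ear_with_nonadjacent_attachments:
  assumes tf: no_triangle
    and w: "distinct w" "3 \<le> length w" "E \<inter> set w \<times> set w = cycle_edges w"
    and K: "conn E K" "K \<inter> set w = {}" "x \<in> K" "y \<in> K"
    and cd: "c \<in> set w" "d \<in> set w" "c \<noteq> d" "(c, d) \<notin> E" "(x, c) \<in> E" "(y, d) \<in> E"
  shows "contains_theta_or_wheel (set w \<union> K)"
proof -
  define Q where "Q = (\<lambda>x y. \<exists>c d. c \<in> set w \<and> d \<in> set w \<and> c \<noteq> d \<and> (c, d) \<notin> E \<and>
    (x, c) \<in> E \<and> (y, d) \<in> E)"
  have Qxy: "Q x y" using cd unfolding Q_def by blast
  obtain p where p: "p \<noteq> []" "set p \<subseteq> K" "distinct p" "E \<inter> set p \<times> set p = list_edges p"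
      "Q (hd p) (last p)"
    and min1: "\<And>A x B. p = A @ x # B \<Longrightarrow> Q x x \<Longrightarrow> A = [] \<and> B = []"
    and min2: "\<And>A x B y C. p = A @ x # B @ y # C \<Longrightarrow> Q x y \<Longrightarrow> A = [] \<and> C = []"
    using shortest_path[where Q = Q, OF K(1,3,4) Qxy] by blast
  obtain a b where ab: "a \<in> set w" "b \<in> set w" "a \<noteq> b" "(a, b) \<notin> E" "(hd p, a) \<in> E" "(last p, b) \<in> E"
    using p(5) unfolding Q_def by blast
  have ba: "(b, a) \<notin> E" using ab(4) E_sym by blast
  have pw: "set p \<inter> set w = {}" using p(2) K(2) by blast
  have tri: False if "(r, s) \<in> E" "(s, t) \<in> E" "(r, t) \<in> E" for r s t
    using tf that unfolding no_triangle_def by blast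
  have "contains_theta_or_wheel (set w \<union> set p)"
  proof (cases "\<forall>x c. x \<in> set p \<longrightarrow> c \<in> set w \<longrightarrow> (x, c) \<in> E \<longrightarrow>
      x = hd p \<and> c = a \<or> x = last p \<and> c = b")
    case True
    then show ?thesis using theta_from_ear[OF w p(1,3) pw p(4) ab] by blast
  next
    case False
    then obtain z e where ze: "z \<in> set p" "e \<in> set w" "(z, e) \<in> E"
        "\<not> (z = hd p \<and> e = a)" "\<not> (z = last p \<and> e = b)" by blast
    show ?thesis
    proof (cases "tl p = []")
      case True
      then obtain s where s: "p = [s]" using p(1) by (cases p) auto
      \<comment> \<open>The only vertex \<open>s\<close> of the path sees three vertices of
        \<open>w\<close>.\<close>
      have "card {a, b, e} = 3" using ab ze s by auto
      moreover have "{a, b, e} \<subseteq> {y \<in> set w. (s, y) \<in> E}" using ab ze s by auto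
      ultimately have "3 \<le> card {y \<in> set w. (s, y) \<in> E}"
        using card_mono[of "{y \<in> set w. (s, y) \<in> E}" "{a, b, e}"] by simp
      then have "wheel_on E (set w \<union> set p) w s" unfolding wheel_on_def using w pw s by auto
      then show ?thesis by (rule contains_wheel)
    next
      case False
      \<comment> \<open>Two neighbours of \<open>t\<close> on \<open>w\<close> would be
        non-adjacent, since there is no triangle, and \<open>[t]\<close> alone would be a shorter
        choice.\<close>
      have uniq: "g = f" if t: "t \<in> set p" "f \<in> set w" "g \<in> set w" "(t, f) \<in> E" "(t, g) \<in> E" for t f g
      proof (rule ccontr)
        assume "g \<noteq> f"
        moreover have "(f, g) \<notin> E" using tri that by blast
        ultimately have Qt: "Q t t" unfolding Q_def using that by blast
        obtain A B where AB: "p = A @ t # B" using t(1) split_list by metis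
        from min1[OF AB Qt] AB show False using False by simp
      qed
      obtain h m l where hml: "p = h # m @ [l]"
        using False p(1) by (metis append_butlast_last_id list.collapse)
      have hl: "(h, a) \<in> E" "(l, b) \<in> E" using ab hml by auto
      \<comment> \<open>By minimality neither \<open>h\<close>, \<open>t\<close> nor
        \<open>t\<close>, \<open>l\<close> attach to non-adjacent vertices. So \<open>f\<close>
        equals or sees \<open>a\<close>, and equals or sees \<open>b\<close>; as \<open>a\<close>
        and \<open>b\<close> are non-adjacent, it sees both.\<close>
      have mid: "f \<in> set w \<and> (f, a) \<in> E \<and> (f, b) \<in> E" if t: "t \<in> set m" "f \<in> set w" "(t, f) \<in> E" for t f
      proof -
        obtain B C where m: "m = B @ t # C" using t split_list by metis
        have "\<not> Q h t" using min2[of "[]" h B t "C @ [l]"] hml m by auto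
        then have 1: "f = a \<or> (a, f) \<in> E" unfolding Q_def using hl t ab by blast
        have "\<not> Q t l" using min2[of "h # B" t C l "[]"] hml m by auto
        then have 2: "f = b \<or> (f, b) \<in> E" unfolding Q_def using hl t ab by blast
        show ?thesis using 1 2 ab ba t E_sym by blast
      qed
      have z: "z \<in> set m"
        using ze ab uniq[of z a e] uniq[of z b e] hml by auto
      have only: "x = hd p \<and> f = a \<or> x = last p \<and> f = b \<or> f = e"
        if x: "x \<in> set p" "f \<in> set w" "(x, f) \<in> E" for x f
      proof (cases "x \<in> set m")
        case True
        \<comment> \<open>Distinct \<open>f\<close> and \<open>e\<close> both see \<open>a\<close>,
          hence are non-adjacent, so \<open>x\<close> and \<open>z\<close> would be a pair of
          attaching vertices strictly inside the path. Either may come first.\<close>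
        have "f = e"
        proof (rule ccontr)
          assume fe: "f \<noteq> e"
          have ea: "(f, a) \<in> E" "(e, a) \<in> E" using mid True x z ze by blast+
          then have nadj: "(f, e) \<notin> E" "(e, f) \<notin> E" using tri E_sym by blast+
          then have Qs: "Q x z" "Q z x" unfolding Q_def using x ze fe by blast+
          have "x \<noteq> z" using uniq x ze fe by blast
          obtain A B where m: "m = A @ x # B" using True split_list by metis
          consider "z \<in> set A" | "z \<in> set B" using z m \<open>x \<noteq> z\<close> by auto
          then show False
          proof cases
            case 1
            then obtain A1 A2 where "A = A1 @ z # A2" using split_list by metis
            then have "p = (h # A1) @ z # A2 @ x # (B @ [l])" using hml m by simp
            from min2[OF this Qs(2)] show False by simp
          next
            case 2
            then obtain B1 B2 where "B = B1 @ z # B2" using split_list by metis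
            then have "p = (h # A) @ x # B1 @ z # (B2 @ [l])" using hml m by simp
            from min2[OF this Qs(1)] show False by simp
          qed
        qed
        then show ?thesis by blast
      next
        case False
        then have "x = hd p \<or> x = last p" using x hml by auto
        then show ?thesis using uniq x ab by blast
      qed
      show ?thesis
        using wheel_from_ear[OF w p(1,3) pw p(4) ab(1,2,3,5,6) ze(2), of z] mid[OF z ze(2,3)] ze only
        by blast
    qed
  qed
  then show ?thesis by (rule contains_mono) (use p(2) in blast)
qed

text \<open>The vertices of \<open>w\<close> seen from a component \<open>K\<close> are pairwise
  adjacent. There are at least two by 2-connectedness, and a third would complete a triangle; so the
  edge between the two cuts \<open>K\<close> off.\<close>

lemma induced_cycle_or_edge_cut:
  assumes S: "two_conn E S" and tf: no_triangle and no: "\<not> contains_theta_or_wheel S"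
  obtains w where "distinct w" "3 \<le> length w" "set w = S" "E \<inter> set w \<times> set w = cycle_edges w"
  | u v where "u \<in> S" "v \<in> S" "(u, v) \<in> E" "\<not> conn E (S - {u, v})"
proof -
  obtain w where w: "distinct w" "3 \<le> length w" "set w \<subseteq> S" "E \<inter> set w \<times> set w = cycle_edges w"
    using induced_cycle_exists[OF S] .
  \<comment> \<open>Such a vertex survives the deletion of \<open>c\<close> and \<open>d\<close>
    outside \<open>K\<close>, so the cut is proper.\<close>
  have third: "\<exists>z \<in> set w. z \<noteq> c \<and> z \<noteq> d" for c d
  proof (rule ccontr)
    assume "\<not> ?thesis"
    then have "set w \<subseteq> {c, d}" by blast
    then have "card (set w) \<le> card {c, d}" by (intro card_mono) auto
    also have "\<dots> \<le> 2" by (simp add: card_insert_if)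
    finally show False using w by (simp add: distinct_card)
  qed
  show ?thesis
  proof (cases "set w = S")
    case True
    then show ?thesis using that(1) w by blast
  next
    case False
    then obtain x where x: "x \<in> S - set w" using w by blast
    have "3 \<le> card S" using S by (simp add: two_conn_def)
    then have "finite (S - set w)" by (auto intro: card_ge_0_finite)
    then obtain K where K: "x \<in> K" "K \<subseteq> S - set w" "conn E K"
        "\<And>a b. a \<in> K \<Longrightarrow> b \<in> S - set w - K \<Longrightarrow> (a, b) \<notin> E"
      using component[OF _ x] by metis
    have clique: "c = d \<or> (c, d) \<in> E"
      if "y \<in> K" "z \<in> K" "c \<in> set w" "d \<in> set w" "(y, c) \<in> E" "(z, d) \<in> E" for y z c d
    proof (rule ccontr)
      assume "\<not> ?thesis"
      moreover have "K \<inter> set w = {}" using K(2) by blast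
      ultimately have "contains_theta_or_wheel (set w \<union> K)"
        using ear_with_nonadjacent_attachments[OF tf w(1,2,4) K(3) _ that(1,2,3,4)] that by blast
      moreover have "set w \<union> K \<subseteq> S" using K(2) w(3) by blast
      ultimately show False using no contains_mono by blast
    qed
    \<comment> \<open>Edges leaving \<open>K\<close> end in \<open>w\<close>, so if
      \<open>S - D\<close> is connected, \<open>K\<close> attaches to \<open>w\<close> outside
      \<open>D\<close>. The sets \<open>{}\<close>, \<open>{c}\<close> and \<open>{c, d}\<close>
      give the successive attachments.\<close>
    have exit: "\<exists>y \<in> K. \<exists>c \<in> set w - D. (y, c) \<in> E"
      if D: "conn E (S - D)" "D \<subseteq> set w" "\<exists>z \<in> set w. z \<notin> D" for D
    proof -
      have "K \<subseteq> S - D" "K \<noteq> {}" "K \<noteq> S - D" using K(1,2) D w(3) by blast+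
      then obtain y c where "y \<in> K" "c \<in> S - D" "c \<notin> K" "(y, c) \<in> E"
        using connD[OF D(1)] by metis
      then show ?thesis using K(4) by blast
    qed
    have "conn E (S - {})" using S by (simp add: two_conn_def)
    then obtain y c where c: "y \<in> K" "c \<in> set w" "(y, c) \<in> E" using exit[of "{}"] third by blast
    have "conn E (S - {c})" using S c(2) w(3) by (auto simp: two_conn_def)
    then obtain z d where d: "z \<in> K" "d \<in> set w" "d \<noteq> c" "(z, d) \<in> E"
      using exit[of "{c}"] third[of c c] c(2) by blast
    have cd: "(c, d) \<in> E" using clique c d by blast
    have "\<not> conn E (S - {c, d})"
    proof
      assume "conn E (S - {c, d})"
      then obtain t e where e: "t \<in> K" "e \<in> set w - {c, d}" "(t, e) \<in> E"
        using exit[of "{c, d}"] third[of c d] c(2) d(2) by blast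
      then have "(c, e) \<in> E" "(d, e) \<in> E" using clique c d by blast+
      then show False using cd tf unfolding no_triangle_def by blast
    qed
    then show ?thesis using that(2) c d cd w(3) by blast
  qed
qed

subsection \<open>Gluing along an edge cut\<close>

text \<open>Since \<open>uv\<close> is an edge, a cut of the side \<open>A\<close> may be taken to avoid \<open>u\<close> and \<open>v\<close>, and is
  then a cut of the whole graph.\<close>

lemma conn_side:
  assumes uv: "(u, v) \<in> E"
    and cross: "\<And>a b. a \<in> A - {u, v} \<Longrightarrow> b \<in> B - {u, v} \<Longrightarrow> (a, b) \<notin> E"
    and AB: "{u, v} \<subseteq> A" "\<not> B \<subseteq> A"
    and D: "D \<subseteq> A" "A - D \<noteq> {}" and conn: "conn E (A \<union> B - D)"
  shows "conn E (A - D)"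
proof (rule connI[OF D(2)], rule ccontr)
  fix M assume M: "M \<subseteq> A - D" "M \<noteq> {}" "M \<noteq> A - D"
    and none: "\<not> (\<exists>a b. a \<in> M \<and> b \<in> A - D \<and> b \<notin> M \<and> (a, b) \<in> E)"
  have cut: False
    if N: "N \<subseteq> A - D" "N \<noteq> {}" "u \<notin> N" "v \<notin> N"
      "\<And>a b. a \<in> N \<Longrightarrow> b \<in> A - D - N \<Longrightarrow> (a, b) \<notin> E" for N
  proof -
    have "N \<subseteq> A \<union> B - D" "N \<noteq> A \<union> B - D" using N(1) AB D(1) by blast+
    then obtain a b where ab: "a \<in> N" "b \<in> A \<union> B - D" "b \<notin> N" "(a, b) \<in> E"
      using connD[OF conn _ N(2)] by metis
    show False
    proof (cases "b \<in> A")
      case True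
      then show False using N(5) ab by blast
    next
      case False
      then have "b \<in> B - {u, v}" "a \<in> A - {u, v}" using ab N AB by auto
      then show False using cross ab(4) by blast
    qed
  qed
  have none': "(a, b) \<notin> E" "(b, a) \<notin> E" if "a \<in> M" "b \<in> A - D - M" for a b
    using none that E_sym by blast+
  have vu: "(v, u) \<in> E" using uv E_sym by blast
  \<comment> \<open>By the edge \<open>uv\<close>, one side of the cut \<open>M\<close> of
    \<open>A - D\<close> contains neither \<open>u\<close> nor \<open>v\<close>: \<open>M\<close>
    itself or its complement.\<close>
  show False
  proof (cases "u \<notin> M \<and> v \<notin> M")
    case True
    then show False using cut[of M] M none' by blast
  next
    case False
    have "A - D - M \<noteq> {}" using M by blast
    moreover have "u \<notin> A - D - M" "v \<notin> A - D - M"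
      using False none'(1)[of u v] none'(1)[of v u] uv vu by blast+
    moreover have "(a, b) \<notin> E" if "a \<in> A - D - M" "b \<in> A - D - (A - D - M)" for a b
      using none'(2) that by blast
    ultimately show False using cut[of "A - D - M"] by blast
  qed
qed

text \<open>A shortest path in \<open>K\<close> from a neighbour of \<open>u\<close> to a neighbour
  of \<open>v\<close> has no further edges to either of them.\<close>

lemma path_through_side:
  assumes S: "two_conn E S" and uv: "u \<in> S" "v \<in> S" "u \<noteq> v"
    and K: "conn E K" "K \<subseteq> S - {u, v}" "\<And>a b. a \<in> K \<Longrightarrow> b \<in> S - {u, v} - K \<Longrightarrow> (a, b) \<notin> E"
  obtains I where "I \<noteq> []" "set I \<subseteq> K" "distinct I"
    "E \<inter> insert u (insert v (set I)) \<times> insert u (insert v (set I)) - {(u, v), (v, u)} =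
      list_edges (u # I @ [v])"
proof -
  have ne: "K \<noteq> {}" using K(1) by (simp add: conn_def)
  \<comment> \<open>With \<open>z'\<close> deleted the graph is still connected, and
    \<open>K\<close> can be left only through \<open>z\<close>.\<close>
  have touch: "\<exists>a \<in> K. (z, a) \<in> E"
    if z: "z \<in> S" "z' \<in> S" "z \<in> {u, v}" "z' \<in> {u, v}" "z \<noteq> z'" "\<And>b. b \<in> {u, v} \<Longrightarrow> b \<noteq> z' \<Longrightarrow> b = z"
    for z z'
  proof -
    have "conn E (S - {z'})" using S z(2) by (simp add: two_conn_def)
    moreover have "K \<subseteq> S - {z'}" "K \<noteq> S - {z'}" using K(2) z(1-5) by blast+
    ultimately obtain a b where ab: "a \<in> K" "b \<in> S - {z'}" "b \<notin> K" "(a, b) \<in> E"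
      using connD[OF _ _ ne] by metis
    then have "b \<in> {u, v}" using K(3)[of a b] by blast
    then have "b = z" using ab z(6) by blast
    then show ?thesis using ab(1) E_sym[OF ab(4)] by blast
  qed
  obtain a b where ab: "a \<in> K" "b \<in> K" "(u, a) \<in> E" "(v, b) \<in> E"
    using touch[of u v] touch[of v u] uv by auto
  define Q where "Q = (\<lambda>a b. (u, a) \<in> E \<and> (v, b) \<in> E)"
  have Qab: "Q a b" using ab by (simp add: Q_def)
  obtain I where I: "I \<noteq> []" "set I \<subseteq> K" "distinct I" "E \<inter> set I \<times> set I = list_edges I"
      "Q (hd I) (last I)"
    and min1: "\<And>A x B. I = A @ x # B \<Longrightarrow> Q x x \<Longrightarrow> A = [] \<and> B = []"
    and min2: "\<And>A x B y C. I = A @ x # B @ y # C \<Longrightarrow> Q x y \<Longrightarrow> A = [] \<and> C = []"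
    using shortest_path[where Q = Q, OF K(1) ab(1,2) Qab] by blast
  have h: "(u, hd I) \<in> E" "(v, last I) \<in> E" "(hd I, u) \<in> E" "(last I, v) \<in> E"
    using I(5) by (auto simp: Q_def intro: E_sym)
  \<comment> \<open>Any neighbour \<open>x\<close> of \<open>u\<close> is related to
    \<open>last I\<close>; whether \<open>x\<close> is itself the last vertex decides which
    minimality condition applies.\<close>
  have nu: "x = hd I" if x: "x \<in> set I" "(u, x) \<in> E" for x
  proof -
    obtain A B where AB: "I = A @ x # B" using split_list[OF x(1)] by blast
    show ?thesis
    proof (cases B rule: rev_cases)
      case Nil
      then have "Q x x" using x h AB by (simp add: Q_def)
      then show ?thesis using min1[OF AB] AB by simp
    next
      case (snoc B' y)
      then have Qxy: "Q x y" and eq: "I = A @ x # B' @ y # []" using x h AB by (simp_all add: Q_def)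
      show ?thesis using min2[OF eq Qxy] eq by simp
    qed
  qed
  have nv: "x = last I" if x: "x \<in> set I" "(v, x) \<in> E" for x
  proof -
    obtain A B where AB: "I = A @ x # B" using split_list[OF x(1)] by blast
    show ?thesis
    proof (cases A)
      case Nil
      then have "Q x x" using x h AB by (simp add: Q_def)
      then show ?thesis using min1[OF AB] AB by simp
    next
      case (Cons y A')
      then have Qyx: "Q y x" and eq: "I = [] @ y # A' @ x # B" using x h AB by (simp_all add: Q_def)
      show ?thesis using min2[OF eq Qyx] eq by simp
    qed
  qed
  let ?T = "insert u (insert v (set I))"
  have uvI: "u \<notin> set I" "v \<notin> set I" using I(2) K(2) by blast+
  have "E \<inter> ?T \<times> ?T - {(u, v), (v, u)} =
      E \<inter> set I \<times> set I \<union> {(u, hd I), (hd I, u), (v, last I), (last I, v)}"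
  proof (intro equalityI subrelI)
    fix x y assume "(x, y) \<in> E \<inter> ?T \<times> ?T - {(u, v), (v, u)}"
    then have "(x, y) \<in> E" "(y, x) \<in> E" "x \<in> ?T" "y \<in> ?T" "(x, y) \<noteq> (u, v)" "(x, y) \<noteq> (v, u)" "x \<noteq> y"
      using E_irrefl by (auto intro: E_sym)
    then show "(x, y) \<in> E \<inter> set I \<times> set I \<union> {(u, hd I), (hd I, u), (v, last I), (last I, v)}"
      using nu[of x] nu[of y] nv[of x] nv[of y] by blast
  next
    fix x y assume "(x, y) \<in> E \<inter> set I \<times> set I \<union> {(u, hd I), (hd I, u), (v, last I), (last I, v)}"
    then show "(x, y) \<in> E \<inter> ?T \<times> ?T - {(u, v), (v, u)}"
      using h uvI I(1) hd_in_set[OF I(1)] last_in_set[OF I(1)] by blast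
  qed
  also have "\<dots> = list_edges (u # I @ [v])"
    unfolding I(4) using I(1) by (auto simp: list_edges_Cons list_edges_snoc)
  finally show ?thesis using that I(1-3) by blast
qed

lemma three_sides_theta:
  assumes S: "two_conn E S" and uv: "u \<in> S" "v \<in> S" "u \<noteq> v"
    and K: "conn E K1" "conn E K2" "conn E K3"
      "K1 \<subseteq> S - {u, v}" "K2 \<subseteq> S - {u, v}" "K3 \<subseteq> S - {u, v}"
      "K1 \<inter> K2 = {}" "K1 \<inter> K3 = {}" "K2 \<inter> K3 = {}"
    and sep1: "\<And>a b. a \<in> K1 \<Longrightarrow> b \<in> S - {u, v} - K1 \<Longrightarrow> (a, b) \<notin> E"
    and sep2: "\<And>a b. a \<in> K2 \<Longrightarrow> b \<in> S - {u, v} - K2 \<Longrightarrow> (a, b) \<notin> E"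
    and sep3: "\<And>a b. a \<in> K3 \<Longrightarrow> b \<in> S - {u, v} - K3 \<Longrightarrow> (a, b) \<notin> E"
  shows "contains_theta_or_wheel S"
proof -
  let ?X = "\<lambda>I. insert u (insert v (set I))"
  obtain I1 where I1: "I1 \<noteq> []" "set I1 \<subseteq> K1" "distinct I1"
    "E \<inter> ?X I1 \<times> ?X I1 - {(u, v), (v, u)} = list_edges (u # I1 @ [v])"
    using path_through_side[OF S uv K(1,4) sep1] by blast
  obtain I2 where I2: "I2 \<noteq> []" "set I2 \<subseteq> K2" "distinct I2"
    "E \<inter> ?X I2 \<times> ?X I2 - {(u, v), (v, u)} = list_edges (u # I2 @ [v])"
    using path_through_side[OF S uv K(2,5) sep2] by blast
  obtain I3 where I3: "I3 \<noteq> []" "set I3 \<subseteq> K3" "distinct I3"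
    "E \<inter> ?X I3 \<times> ?X I3 - {(u, v), (v, u)} = list_edges (u # I3 @ [v])"
    using path_through_side[OF S uv K(3,6) sep3] by blast
  let ?T = "{u, v} \<union> set I1 \<union> set I2 \<union> set I3"
  have cross: "(x, y) \<notin> E"
    if "x \<in> set I1 \<and> y \<in> set I2 \<or> x \<in> set I1 \<and> y \<in> set I3 \<or> x \<in> set I2 \<and> y \<in> set I1 \<or>
      x \<in> set I2 \<and> y \<in> set I3 \<or> x \<in> set I3 \<and> y \<in> set I1 \<or> x \<in> set I3 \<and> y \<in> set I2" for x y
  proof -
    have "x \<in> K1 \<and> y \<in> S - {u, v} - K1 \<or> x \<in> K2 \<and> y \<in> S - {u, v} - K2 \<or>
        x \<in> K3 \<and> y \<in> S - {u, v} - K3"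
      using that I1(2) I2(2) I3(2) K(4-9) by blast
    then show ?thesis using sep1 sep2 sep3 by blast
  qed
  have "E \<inter> ?T \<times> ?T - {(u, v), (v, u)} =
      (E \<inter> ?X I1 \<times> ?X I1 - {(u, v), (v, u)}) \<union> (E \<inter> ?X I2 \<times> ?X I2 - {(u, v), (v, u)}) \<union>
      (E \<inter> ?X I3 \<times> ?X I3 - {(u, v), (v, u)})"
  proof (intro equalityI subrelI)
    fix x y assume xy: "(x, y) \<in> E \<inter> ?T \<times> ?T - {(u, v), (v, u)}"
    then have "x \<in> ?T" "y \<in> ?T" "(x, y) \<in> E" by blast+
    then have "(x, y) \<in> ?X I1 \<times> ?X I1 \<union> ?X I2 \<times> ?X I2 \<union> ?X I3 \<times> ?X I3"
      using cross[of x y]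
      by (simp only: Un_iff insert_iff empty_iff mem_Times_iff fst_conv snd_conv) argo
    then show "(x, y) \<in> (E \<inter> ?X I1 \<times> ?X I1 - {(u, v), (v, u)}) \<union>
        (E \<inter> ?X I2 \<times> ?X I2 - {(u, v), (v, u)}) \<union> (E \<inter> ?X I3 \<times> ?X I3 - {(u, v), (v, u)})"
      using xy by blast
  qed auto
  then have "E \<inter> ?T \<times> ?T - {(u, v), (v, u)} =
      list_edges (u # I1 @ [v]) \<union> list_edges (u # I2 @ [v]) \<union> list_edges (u # I3 @ [v])"
    unfolding I1(4) I2(4) I3(4) .
  moreover have "distinct (u # v # I1 @ I2 @ I3)"
  proof -
    have "set I1 \<inter> set I2 = {}" "set I1 \<inter> set I3 = {}" "set I2 \<inter> set I3 = {}"
      "{u, v} \<inter> (set I1 \<union> set I2 \<union> set I3) = {}"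
      using I1(2) I2(2) I3(2) K(4-9) by blast+
    then show ?thesis using I1(3) I2(3) I3(3) uv(3) by auto
  qed
  ultimately have "theta_on E ?T u v I1 I2 I3"
    unfolding theta_on_def using I1(1) I2(1) I3(1) by blast
  moreover have "?T \<subseteq> S" using uv I1(2) I2(2) I3(2) K(4-6) by blast
  ultimately show ?thesis using contains_mono[OF contains_theta] by metis
qed

text \<open>The condition on noncut edges makes the Hamiltonian cycles of the two sides of an edge
  cut \<open>uv\<close> both pass through \<open>uv\<close>.\<close>

definition ham_noncut :: "'a set \<Rightarrow> bool" where
  "ham_noncut S \<longleftrightarrow> (\<exists>p. distinct p \<and> 3 \<le> length p \<and> set p = S \<and> cycle_edges p \<subseteq> E \<and>
     (\<forall>x \<in> S. \<forall>y \<in> S. (x, y) \<in> E \<longrightarrow> conn E (S - {x, y}) \<longrightarrow> (x, y) \<in> cycle_edges p))"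

text \<open>Both cycles contain \<open>uv\<close>; opened there, they join to one cycle that omits
  it, which is allowed because \<open>uv\<close> is a cut of the union. Every other noncut edge lies
  in one side, is noncut there by \<open>conn_side\<close>, and so is on the path of that
  side.\<close>

lemma ham_noncut_glue:
  assumes uv: "(u, v) \<in> E" and AB: "A \<inter> B = {u, v}" "\<not> A \<subseteq> B" "\<not> B \<subseteq> A"
    and cross: "\<And>a b. a \<in> A - {u, v} \<Longrightarrow> b \<in> B - {u, v} \<Longrightarrow> (a, b) \<notin> E"
    and conn: "conn E (A - {u, v})" "conn E (B - {u, v})" "\<not> conn E (A \<union> B - {u, v})"
    and ham: "ham_noncut A" "ham_noncut B"
  shows "ham_noncut (A \<union> B)"
proof -
  have path: "\<exists>I. distinct (u # I @ [v]) \<and> set (u # I @ [v]) = C \<and> I \<noteq> [] \<and> list_edges (u # I @ [v]) \<subseteq> E \<and>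
      (\<forall>x \<in> C. \<forall>y \<in> C. (x, y) \<in> E \<longrightarrow> conn E (C - {x, y}) \<longrightarrow> {x, y} \<noteq> {u, v} \<longrightarrow>
        (x, y) \<in> list_edges (u # I @ [v]))"
    if C: "ham_noncut C" "{u, v} \<subseteq> C" "conn E (C - {u, v})" for C
  proof -
    obtain p where p: "distinct p" "3 \<le> length p" "set p = C" "cycle_edges p \<subseteq> E"
        "\<And>x y. x \<in> C \<Longrightarrow> y \<in> C \<Longrightarrow> (x, y) \<in> E \<Longrightarrow> conn E (C - {x, y}) \<Longrightarrow> (x, y) \<in> cycle_edges p"
      using C(1) unfolding ham_noncut_def by blast
    have "(u, v) \<in> cycle_edges p" using p(5)[of u v] C(2,3) uv by blast
    then obtain q where q: "distinct q" "set q = set p" "length q = length p" "hd q = u" "last q = v"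
        "cycle_edges q = cycle_edges p"
      using cycle_open_at_edge[OF p(1,2)] by blast
    obtain q' where q': "q = u # q'" using q(3,4) p(2) by (cases q) auto
    then have "q' \<noteq> []" using q(3) p(2) by auto
    then obtain I where I: "q = u # I @ [v]" using q' q(5) by (metis append_butlast_last_id last_ConsR)
    have ceq: "cycle_edges q = insert (v, u) (insert (u, v) (list_edges q))"
      using q(4,5) I by (subst cycle_edges_eq) auto
    moreover have "I \<noteq> []" using q(3) p(2) I by auto
    moreover have "(x, y) \<in> list_edges q"
      if "x \<in> C" "y \<in> C" "(x, y) \<in> E" "conn E (C - {x, y})" "{x, y} \<noteq> {u, v}" for x y
    proof -
      have "(x, y) \<in> cycle_edges q" using p(5) that q(6) by blast
      then show ?thesis using that(5) unfolding ceq by auto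
    qed
    ultimately show ?thesis
      using p(3,4) q(1,2,6) unfolding I by (intro exI[of _ I]) blast
  qed
  have uvA: "{u, v} \<subseteq> A" and uvB: "{u, v} \<subseteq> B" using AB(1) by blast+
  obtain I where I: "distinct (u # I @ [v])" "set (u # I @ [v]) = A" "I \<noteq> []" "list_edges (u # I @ [v]) \<subseteq> E"
      "\<forall>x \<in> A. \<forall>y \<in> A. (x, y) \<in> E \<longrightarrow> conn E (A - {x, y}) \<longrightarrow> {x, y} \<noteq> {u, v} \<longrightarrow>
        (x, y) \<in> list_edges (u # I @ [v])"
    using path[OF ham(1) uvA conn(1)] by blast
  obtain J where J: "distinct (u # J @ [v])" "set (u # J @ [v]) = B" "J \<noteq> []" "list_edges (u # J @ [v]) \<subseteq> E"
      "\<forall>x \<in> B. \<forall>y \<in> B. (x, y) \<in> E \<longrightarrow> conn E (B - {x, y}) \<longrightarrow> {x, y} \<noteq> {u, v} \<longrightarrow>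
        (x, y) \<in> list_edges (u # J @ [v])"
    using path[OF ham(2) uvB conn(2)] by blast
  let ?c = "u # I @ v # rev J"
  note ce = cycle_edges_two_paths[of u I v J]
  have "set I \<inter> set J = {}"
  proof -
    have "set I \<inter> set J \<subseteq> {u, v}" using I(2) J(2) AB(1) by auto
    moreover have "u \<notin> set I" "v \<notin> set I" using I(1) by auto
    ultimately show ?thesis by blast
  qed
  then have "distinct ?c" using I(1) J(1) by auto
  moreover have "set ?c = A \<union> B" using I(2) J(2) by auto
  moreover have "3 \<le> length ?c" using I(3) by (cases I) auto
  moreover have "cycle_edges ?c \<subseteq> E" unfolding ce using I(4) J(4) by blast
  moreover have "(x, y) \<in> cycle_edges ?c"
    if xy: "x \<in> A \<union> B" "y \<in> A \<union> B" "(x, y) \<in> E" "conn E (A \<union> B - {x, y})" for x y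
  proof -
    have ne: "{x, y} \<noteq> {u, v}" using xy(4) conn(3) by metis
    have same: "x \<in> A \<and> y \<in> A \<or> x \<in> B \<and> y \<in> B"
      using cross[of x y] cross[of y x] xy E_sym[OF xy(3)] AB(1) by blast
    \<comment> \<open>Supplies the nonemptiness that \<open>conn_side\<close> asks for: a side has
      at least three vertices.\<close>
    have more: "C - {x, y} \<noteq> {}" if "{u, v} \<subseteq> C" "conn E (C - {u, v})" for C
    proof -
      have "C - {u, v} \<noteq> {}" using that(2) by (simp add: conn_def)
      then obtain z where "z \<in> C" "z \<noteq> u" "z \<noteq> v" by blast
      moreover have "u \<noteq> v" using uv E_irrefl by blast
      ultimately show ?thesis using that(1) by auto
    qed
    have "(x, y) \<in> list_edges (u # I @ [v])" if C: "x \<in> A" "y \<in> A"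
    proof -
      have "conn E (A - {x, y})"
        by (rule conn_side[OF uv cross]) (use AB C xy(4) more[of A] conn(1) in auto)
      then show ?thesis using I(5) C xy(3) ne by blast
    qed
    moreover have "(x, y) \<in> list_edges (u # J @ [v])" if C: "x \<in> B" "y \<in> B"
    proof -
      have "conn E (B \<union> A - {x, y})" using xy(4) by (simp add: Un_commute)
      moreover have "(a, b) \<notin> E" if "a \<in> B - {u, v}" "b \<in> A - {u, v}" for a b
        using cross that E_sym by blast
      ultimately have "conn E (B - {x, y})"
        using conn_side[OF uv, of B A "{x, y}"] AB C more[of B] conn(2) by blast
      then show ?thesis using J(5) C xy(3) ne by blast
    qed
    ultimately show ?thesis unfolding ce using same by blast
  qed
  ultimately show ?thesis unfolding ham_noncut_def by blast
qed

lemma two_conn_side: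
  assumes S: "two_conn E (A \<union> B)" and uv: "(u, v) \<in> E" "A \<inter> B = {u, v}" "\<not> A \<subseteq> B" "\<not> B \<subseteq> A"
    and cross: "\<And>a b. a \<in> A - {u, v} \<Longrightarrow> b \<in> B - {u, v} \<Longrightarrow> (a, b) \<notin> E"
  shows "two_conn E A"
proof -
  have "3 \<le> card (A \<union> B)" using S by (simp add: two_conn_def)
  then have "finite (A \<union> B)" by (intro card_ge_0_finite) linarith
  then have fin: "finite A" by simp
  obtain a where a: "a \<in> A" "a \<notin> B" using uv by blast
  have "u \<noteq> v" using uv(1) E_irrefl by blast
  moreover have "a \<noteq> u" "a \<noteq> v" using a uv(2) by blast+
  ultimately have c3: "card {a, u, v} = 3" by simp
  have sub: "{a, u, v} \<subseteq> A" using a uv(2) by blast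
  have 3: "3 \<le> card A" using card_mono[OF fin sub] c3 by simp
  have side: "conn E (A - D)" if "D \<subseteq> A" "A - D \<noteq> {}" "conn E (A \<union> B - D)" for D
    by (rule conn_side[OF uv(1) cross]) (use that uv in auto)
  have "conn E A" using side[of "{}"] S a by (auto simp: two_conn_def)
  moreover have "conn E (A - {x})" if "x \<in> A" for x
  proof (rule side)
    show "A - {x} \<noteq> {}" using sub \<open>u \<noteq> v\<close> by auto
  qed (use S that in \<open>auto simp: two_conn_def\<close>)
  ultimately show ?thesis using 3 by (simp add: two_conn_def)
qed

section \<open>Induction over edge cuts\<close>

theorem triangle_free_ham_or_theta_or_wheel:
  assumes "two_conn E S" no_triangle "\<not> contains_theta_or_wheel S"
  shows "ham_noncut S"
  using assms(1,3)
proof (induction "card S" arbitrary: S rule: less_induct)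
  case (less S)
  note S = less.prems(1) and no = less.prems(2)
  from S no show ?case
  proof (cases rule: induced_cycle_or_edge_cut[OF S assms(2) no, case_names cycle cut])
    case (cycle w)
    \<comment> \<open>An induced cycle through all vertices contains every edge, so the condition on
      noncut edges holds at once.\<close>
    have "(x, y) \<in> cycle_edges w" if "x \<in> S" "y \<in> S" "(x, y) \<in> E" for x y
      using cycle that by blast
    then show ?thesis unfolding ham_noncut_def using cycle by (intro exI[of _ w]) blast
  next
    case (cut u v)
    have fin: "finite S" using S by (auto simp: two_conn_def intro: card_ge_0_finite)
    have neq: "u \<noteq> v" using cut E_irrefl by blast
    let ?T = "S - {u, v}"
    have finT: "finite ?T" using fin by simp
    have "?T \<noteq> {}"
    proof
      assume "?T = {}"
      then have "card S \<le> card {u, v}" by (intro card_mono) auto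
      also have "\<dots> \<le> 2" by (simp add: card_insert_if)
      finally show False using S by (simp add: two_conn_def)
    qed
    then obtain x where x: "x \<in> ?T" by blast
    obtain K where K: "x \<in> K" "K \<subseteq> ?T" "conn E K" "\<And>a b. a \<in> K \<Longrightarrow> b \<in> ?T - K \<Longrightarrow> (a, b) \<notin> E"
      using component[OF finT x] by blast
    let ?R = "?T - K"
    have finR: "finite ?R" using finT by simp
    have "?R \<noteq> {}" using K(2,3) cut(4) by (metis Diff_eq_empty_iff subset_antisym)
    have sepR: "(a, b) \<notin> E" if "a \<in> ?R" "b \<in> K" for a b
      using K(4) that E_sym by blast
    have connR: "conn E ?R"
    proof (rule ccontr)
      assume nR: "\<not> conn E ?R"
      obtain y where y: "y \<in> ?R" using \<open>?R \<noteq> {}\<close> by blast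
      obtain K2 where K2: "y \<in> K2" "K2 \<subseteq> ?R" "conn E K2" "\<And>a b. a \<in> K2 \<Longrightarrow> b \<in> ?R - K2 \<Longrightarrow> (a, b) \<notin> E"
        using component[OF finR y] by blast
      have "?R - K2 \<noteq> {}" using K2(2,3) nR by (metis Diff_eq_empty_iff subset_antisym)
      then obtain z where z: "z \<in> ?R - K2" by blast
      have "finite (?R - K2)" using finR by simp
      then obtain K3 where K3: "z \<in> K3" "K3 \<subseteq> ?R - K2" "conn E K3"
          "\<And>a b. a \<in> K3 \<Longrightarrow> b \<in> ?R - K2 - K3 \<Longrightarrow> (a, b) \<notin> E"
        using component[OF _ z] by blast
      \<comment> \<open>No edge joins \<open>?R\<close> to \<open>K\<close>, so pieces that are
        separated within \<open>?R\<close> are separated in \<open>?T\<close>; with \<open>K\<close>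
        there are now three sides.\<close>
      have s2: "(a, b) \<notin> E" if "a \<in> K2" "b \<in> ?T - K2" for a b
        using that K2(2,4) sepR by blast
      have s3: "(a, b) \<notin> E" if "a \<in> K3" "b \<in> ?T - K3" for a b
      proof (cases "b \<in> K2")
        case True
        then show ?thesis using K2(4)[of b a] that(1) K3(2) E_sym by blast
      next
        case False
        then show ?thesis using that K3(2,4) sepR by blast
      qed
      have "contains_theta_or_wheel S"
        by (rule three_sides_theta[OF S cut(1,2) neq K(3) K2(3) K3(3)])
          (use K(2,4) K2(2) K3(2) s2 s3 in blast)+
      then show False using no by blast
    qed
    define A where "A = K \<union> {u, v}"
    define B where "B = ?R \<union> {u, v}"
    have AB: "A \<union> B = S" "A \<inter> B = {u, v}" "\<not> A \<subseteq> B" "\<not> B \<subseteq> A" "A - {u, v} = K" "B - {u, v} = ?R"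
      using K(1,2) cut(1,2) \<open>?R \<noteq> {}\<close> unfolding A_def B_def by blast+
    have crossA: "(a, b) \<notin> E" if "a \<in> A - {u, v}" "b \<in> B - {u, v}" for a b
      using that K(4) AB by blast
    have crossB: "(a, b) \<notin> E" if "a \<in> B - {u, v}" "b \<in> A - {u, v}" for a b
      using that crossA E_sym by blast
    have BA: "B \<union> A = S" "B \<inter> A = {u, v}" using AB(1,2) by blast+
    have SAB: "two_conn E (A \<union> B)" and SBA: "two_conn E (B \<union> A)" using S by (simp_all only: AB(1) BA(1))
    have "two_conn E A" using two_conn_side[OF SAB cut(3) AB(2-4) crossA] by blast
    moreover have "two_conn E B" using two_conn_side[OF SBA cut(3) BA(2) AB(4,3) crossB] by blast
    moreover have "A \<subset> S" "B \<subset> S" using AB(1,3,4) by blast+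
    then have "card A < card S" "card B < card S" using fin by (simp_all add: psubset_card_mono)
    moreover have "\<not> contains_theta_or_wheel A" "\<not> contains_theta_or_wheel B"
      using no contains_mono AB(1) by blast+
    ultimately have "ham_noncut A" "ham_noncut B" using less.hyps by blast+
    moreover have "conn E (A - {u, v})" "conn E (B - {u, v})" "\<not> conn E (A \<union> B - {u, v})"
      using K(3) connR cut(4) by (simp_all only: AB not_False_eq_True)
    ultimately have "ham_noncut (A \<union> B)"
      using ham_noncut_glue[OF cut(3) AB(2-4) crossA] by blast
    then show ?thesis by (simp only: AB(1))
  qed
qed

end

section \<open>Translation to pair graphs\<close>

text \<open>The set of vertices reachable from \<open>u\<close> is left by no arc; conversely, a
  walk cannot escape a set that no arc leaves.\<close>

lemma conn_iff_rtrancl_on: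
  "conn E X \<longleftrightarrow> X \<noteq> {} \<and> (\<forall>u \<in> X. \<forall>v \<in> X. (u, v) \<in> rtrancl_on X (E \<inter> X \<times> X))"
proof (intro iffI conjI ballI)
  assume c: "conn E X"
  then show "X \<noteq> {}" by (simp add: conn_def)
  fix u v assume u: "u \<in> X" and v: "v \<in> X"
  let ?R = "{y \<in> X. (u, y) \<in> rtrancl_on X (E \<inter> X \<times> X)}"
  have "?R = X"
  proof (rule ccontr)
    assume "?R \<noteq> X"
    moreover have "u \<in> ?R" using u by simp
    ultimately obtain a b where "a \<in> ?R" "b \<in> X" "b \<notin> ?R" "(a, b) \<in> E"
      using connD[OF c, of ?R] by blast
    then show False by (auto intro: rtrancl_on_into_rtrancl_on)
  qed
  then show "(u, v) \<in> rtrancl_on X (E \<inter> X \<times> X)" using v by blast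
next
  assume r: "X \<noteq> {} \<and> (\<forall>u \<in> X. \<forall>v \<in> X. (u, v) \<in> rtrancl_on X (E \<inter> X \<times> X))"
  show "conn E X"
  proof (rule connI, use r in blast, rule ccontr)
    fix M assume M: "M \<subseteq> X" "M \<noteq> {}" "M \<noteq> X"
      and none: "\<not> (\<exists>a b. a \<in> M \<and> b \<in> X \<and> b \<notin> M \<and> (a, b) \<in> E)"
    obtain a b where ab: "a \<in> M" "b \<in> X" "b \<notin> M" using M by blast
    have "(a, b) \<in> rtrancl_on X (E \<inter> X \<times> X)" using r ab M(1) by blast
    then have "b \<in> M"
      by (induction rule: rtrancl_on_induct) (use ab none in blast)+
    then show False using ab by blast
  qed
qed

lemma conn_Int: "conn (E \<inter> S \<times> S) X \<longleftrightarrow> conn E X" if "X \<subseteq> S"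
  using that unfolding conn_def by blast

text \<open>\<open>connected\<close> means strong connectivity of the symmetric closure, which adds
  no arcs to a symmetric graph.\<close>

lemma connected_induce_subgraph_iff:
  assumes "sym (parcs G)"
  shows "connected (with_proj G \<restriction> X) \<longleftrightarrow> conn (parcs G) X"
proof -
  have "parcs (mk_symmetric (with_proj G \<restriction> X)) = parcs G \<inter> X \<times> X"
    using assms by (fastforce simp: parcs_mk_symmetric sym_def)
  then show ?thesis
    unfolding connected_def strongly_connected_def reachable_def conn_iff_rtrancl_on by simp
qed

definition induced_on :: "'a pair_pre_digraph \<Rightarrow> 'a set \<Rightarrow> 'a pair_pre_digraph" where
  "induced_on G S = \<lparr>pverts = S, parcs = parcs G \<inter> S \<times> S\<rparr>"

lemma pverts_induced_on [simp]: "pverts (induced_on G S) = S"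
  by (simp add: induced_on_def)

context pair_graph
begin

lemma sym_parcs: "sym (parcs G)"
  using pair_sym_arcs by (simp add: symmetric_def)

lemma parcs_subset: "parcs G \<subseteq> pverts G \<times> pverts G"
  using in_arcsD1 in_arcsD2 by auto

sublocale ugraph "parcs G"
proof
  show "(y, x) \<in> parcs G" if "(x, y) \<in> parcs G" for x y using that sym_parcs by (rule symD[rotated])
  show "(x, x) \<notin> parcs G" for x using pair_no_loops[of "(x, x)"] by auto
qed

lemma induced_on_pverts [simp]: "induced_on G (pverts G) = G"
  using parcs_subset by (cases G) (auto simp: induced_on_def)

lemma induced_subgraph_iff:
  "induced_subgraph (with_proj K) (with_proj G) \<longleftrightarrow> pverts K \<subseteq> pverts G \<and> K = induced_on G (pverts K)"
proof
  assume "induced_subgraph (with_proj K) (with_proj G)"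
  then show "pverts K \<subseteq> pverts G \<and> K = induced_on G (pverts K)"
    unfolding induced_subgraph_def subgraph_def
    by (cases K) (auto simp: induced_on_def)
next
  assume K: "pverts K \<subseteq> pverts G \<and> K = induced_on G (pverts K)"
  then have arcs: "parcs K = parcs G \<inter> pverts K \<times> pverts K"
    by (metis induced_on_def pair_pre_digraph.select_convs(2))
  have "wf_digraph (with_proj K)" by unfold_locales (auto simp: arcs)
  moreover have "wf_digraph (with_proj G)" by unfold_locales
  ultimately show "induced_subgraph (with_proj K) (with_proj G)"
    unfolding induced_subgraph_def subgraph_def compatible_def using K arcs by auto
qed

lemma two_connected_induced_on:
  assumes "S \<subseteq> pverts G"
  shows "two_connected (induced_on G S) \<longleftrightarrow> two_conn (parcs G) S"
proof -
  let ?K = "induced_on G S"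
  have sym: "sym (parcs ?K)" using sym_parcs by (auto simp: induced_on_def sym_def)
  have "with_proj ?K = with_proj ?K \<restriction> S"
    by (auto simp: with_proj_def induce_subgraph_def induced_on_def)
  then have "connected (with_proj ?K) \<longleftrightarrow> conn (parcs G) S"
    using connected_induce_subgraph_iff[OF sym, of S] conn_Int[of S S "parcs G"]
    by (simp add: induced_on_def)
  moreover have "connected (with_proj ?K \<restriction> (S - {v})) \<longleftrightarrow> conn (parcs G) (S - {v})" for v
    using connected_induce_subgraph_iff[OF sym, of "S - {v}"] conn_Int[of "S - {v}" S "parcs G"]
    by (simp add: induced_on_def)
  moreover have "pverts ?K = S" by (simp add: induced_on_def)
  ultimately show ?thesis unfolding two_connected_def two_conn_def by simp
qed

lemma hamiltonian_induced_on:
  "(\<exists>C. hamiltonian_cycle C (induced_on G S)) \<longleftrightarrow> ham (parcs G) S"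
proof
  assume "\<exists>C. hamiltonian_cycle C (induced_on G S)"
  then show "ham (parcs G) S"
    unfolding hamiltonian_cycle_def is_cycle_def spanning_def subgraph_def ham_def
    by (fastforce simp: induced_on_def)
next
  assume "ham (parcs G) S"
  then obtain p where p: "distinct p" "3 \<le> length p" "set p = S" "cycle_edges p \<subseteq> parcs G"
    unfolding ham_def by blast
  let ?C = "\<lparr>pverts = set p, parcs = cycle_edges p\<rparr>"
  have "wf_digraph (with_proj ?C)"
    using cycle_edges_subset[of p] by unfold_locales auto
  moreover have "wf_digraph (with_proj (induced_on G S))"
    by unfold_locales (auto simp: induced_on_def)
  ultimately have "hamiltonian_cycle ?C (induced_on G S)"
    unfolding hamiltonian_cycle_def is_cycle_def spanning_def subgraph_def compatible_def
    using p cycle_edges_subset[of p] by (auto simp: induced_on_def)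
  then show "\<exists>C. hamiltonian_cycle C (induced_on G S)" by blast
qed

lemma HC_obstruction_iff:
  "HC_obstruction G \<longleftrightarrow> two_conn (parcs G) (pverts G) \<and> \<not> ham (parcs G) (pverts G) \<and>
     (\<forall>S \<subseteq> pverts G. two_conn (parcs G) S \<longrightarrow> S = pverts G \<or> ham (parcs G) S)"
proof -
  have "(\<forall>K. induced_subgraph (with_proj K) (with_proj G) \<longrightarrow>
        K = G \<or> \<not> two_connected K \<or> (\<exists>C. hamiltonian_cycle C K)) \<longleftrightarrow>
      (\<forall>S \<subseteq> pverts G. induced_on G S = G \<or> \<not> two_connected (induced_on G S) \<or>
        (\<exists>C. hamiltonian_cycle C (induced_on G S)))"
    (is "?L \<longleftrightarrow> ?R")
  proof
    assume ?L
    then show ?R by (simp add: induced_subgraph_iff)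
  next
    assume R: ?R
    show ?L
    proof (intro allI impI)
      fix K assume "induced_subgraph (with_proj K) (with_proj G)"
      then have "pverts K \<subseteq> pverts G" and eq: "induced_on G (pverts K) = K"
        by (simp_all add: induced_subgraph_iff)
      then show "K = G \<or> \<not> two_connected K \<or> (\<exists>C. hamiltonian_cycle C K)"
        using R[rule_format, of "pverts K"] by simp
    qed
  qed
  also have "\<dots> \<longleftrightarrow> (\<forall>S \<subseteq> pverts G. two_conn (parcs G) S \<longrightarrow> S = pverts G \<or> ham (parcs G) S)"
    unfolding hamiltonian_induced_on
    using two_connected_induced_on by (metis induced_on_pverts pverts_induced_on)
  finally show ?thesis
    unfolding HC_obstruction_def
    using two_connected_induced_on[of "pverts G"] hamiltonian_induced_on[of "pverts G"] by simp
qed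

lemma triangle_free_iff: "triangle_free G \<longleftrightarrow> no_triangle"
proof
  assume t: "triangle_free G"
  show no_triangle
    unfolding no_triangle_def
  proof (intro allI impI notI)
    fix x y z assume e: "(x, y) \<in> parcs G" "(y, z) \<in> parcs G" "(x, z) \<in> parcs G"
    then have "x \<noteq> y" "y \<noteq> z" "x \<noteq> z" using E_irrefl by auto
    then have "card {x, y, z} = 3" by simp
    moreover have "clique G {x, y, z}"
      unfolding clique_def using e e[THEN E_sym] parcs_subset by auto
    ultimately show False using t unfolding triangle_free_def by blast
  qed
next
  assume n: no_triangle
  show "triangle_free G"
    unfolding triangle_free_def
  proof (intro notI, elim exE conjE)
    fix S assume S: "clique G S" "card S = 3"
    then obtain x y z where "S = {x, y, z}" "x \<noteq> y" "y \<noteq> z" "x \<noteq> z" by (auto simp: card_3_iff)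
    then have "(x, y) \<in> parcs G" "(y, z) \<in> parcs G" "(x, z) \<in> parcs G"
      using S(1) unfolding clique_def by auto
    then show False using n unfolding no_triangle_def by blast
  qed
qed

end

section \<open>Thetas and wheels in terms of \<open>theta_on\<close> and
  \<open>wheel_on\<close>\<close>

lemma path_between_iff:
  "path_between u P v \<and> 2 \<le> vwalk_length P \<longleftrightarrow> (\<exists>I. I \<noteq> [] \<and> P = u # I @ [v] \<and> distinct P)"
proof
  assume P: "path_between u P v \<and> 2 \<le> vwalk_length P"
  then obtain P' where P': "P = u # P'" unfolding path_between_def by (cases P) auto
  then have "P' \<noteq> []" "last P' = v" using P unfolding path_between_def by auto
  then obtain I where "P' = I @ [v]" by (metis append_butlast_last_id)
  then show "\<exists>I. I \<noteq> [] \<and> P = u # I @ [v] \<and> distinct P"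
    using P P' unfolding path_between_def by (intro exI[of _ I]) auto
next
  assume "\<exists>I. I \<noteq> [] \<and> P = u # I @ [v] \<and> distinct P"
  then obtain I where "I \<noteq> []" "P = u # I @ [v]" "distinct P" by blast
  then show "path_between u P v \<and> 2 \<le> vwalk_length P"
    unfolding path_between_def by (cases I) auto
qed

lemma theta_with_ends_iff:
  "theta_with_ends H u v \<longleftrightarrow> (u, v) \<notin> parcs H \<and>
    (\<exists>I1 I2 I3. I1 \<noteq> [] \<and> I2 \<noteq> [] \<and> I3 \<noteq> [] \<and> distinct (u # v # I1 @ I2 @ I3) \<and>
      pverts H = {u, v} \<union> set I1 \<union> set I2 \<union> set I3 \<and>
      parcs H = list_edges (u # I1 @ [v]) \<union> list_edges (u # I2 @ [v]) \<union> list_edges (u # I3 @ [v]))"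
proof (intro iffI conjI; (elim conjE)?)
  assume "theta_with_ends H u v"
  then obtain P1 P2 P3 where uv: "(u, v) \<notin> parcs H"
    and P: "path_between u P1 v \<and> 2 \<le> vwalk_length P1" "path_between u P2 v \<and> 2 \<le> vwalk_length P2"
      "path_between u P3 v \<and> 2 \<le> vwalk_length P3"
    and disj: "(set P1 - {u, v}) \<inter> (set P2 - {u, v}) = {}" "(set P1 - {u, v}) \<inter> (set P3 - {u, v}) = {}"
      "(set P2 - {u, v}) \<inter> (set P3 - {u, v}) = {}"
    and H: "H = \<lparr>pverts = set P1 \<union> set P2 \<union> set P3,
             parcs = list_edges P1 \<union> list_edges P2 \<union> list_edges P3\<rparr>"
    unfolding theta_with_ends_def by blast
  obtain I1 I2 I3 where I: "I1 \<noteq> []" "P1 = u # I1 @ [v]" "distinct P1"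
      "I2 \<noteq> []" "P2 = u # I2 @ [v]" "distinct P2" "I3 \<noteq> []" "P3 = u # I3 @ [v]" "distinct P3"
    using P unfolding path_between_iff by blast
  have "set P1 - {u, v} = set I1" "set P2 - {u, v} = set I2" "set P3 - {u, v} = set I3"
    using I by auto
  then have "distinct (u # v # I1 @ I2 @ I3)" using disj I by auto
  then show "\<exists>I1 I2 I3. I1 \<noteq> [] \<and> I2 \<noteq> [] \<and> I3 \<noteq> [] \<and> distinct (u # v # I1 @ I2 @ I3) \<and>
      pverts H = {u, v} \<union> set I1 \<union> set I2 \<union> set I3 \<and>
      parcs H = list_edges (u # I1 @ [v]) \<union> list_edges (u # I2 @ [v]) \<union> list_edges (u # I3 @ [v])"
    using I H by (intro exI[of _ I1] exI[of _ I2] exI[of _ I3]) auto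
  show "(u, v) \<notin> parcs H" by (fact uv)
next
  assume uv: "(u, v) \<notin> parcs H" and "\<exists>I1 I2 I3. I1 \<noteq> [] \<and> I2 \<noteq> [] \<and> I3 \<noteq> [] \<and> distinct (u # v # I1 @ I2 @ I3) \<and>
      pverts H = {u, v} \<union> set I1 \<union> set I2 \<union> set I3 \<and>
      parcs H = list_edges (u # I1 @ [v]) \<union> list_edges (u # I2 @ [v]) \<union> list_edges (u # I3 @ [v])"
  then obtain I1 I2 I3 where I: "I1 \<noteq> []" "I2 \<noteq> []" "I3 \<noteq> []" and d: "distinct (u # v # I1 @ I2 @ I3)"
    and H: "pverts H = {u, v} \<union> set I1 \<union> set I2 \<union> set I3"
      "parcs H = list_edges (u # I1 @ [v]) \<union> list_edges (u # I2 @ [v]) \<union> list_edges (u # I3 @ [v])"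
    by blast
  let ?P = "\<lambda>I. u # I @ [v]"
  have "H = \<lparr>pverts = set (?P I1) \<union> set (?P I2) \<union> set (?P I3),
      parcs = list_edges (?P I1) \<union> list_edges (?P I2) \<union> list_edges (?P I3)\<rparr>"
    by (rule pair_pre_digraph.equality) (use H in auto)
  moreover have "path_between u (?P I1) v \<and> 2 \<le> vwalk_length (?P I1)"
    "path_between u (?P I2) v \<and> 2 \<le> vwalk_length (?P I2)"
    "path_between u (?P I3) v \<and> 2 \<le> vwalk_length (?P I3)"
    unfolding path_between_iff using I d by auto
  moreover have "set (?P I1) - {u, v} = set I1" "set (?P I2) - {u, v} = set I2" "set (?P I3) - {u, v} = set I3"
    using d by auto
  moreover have "set I1 \<inter> set I2 = {}" "set I1 \<inter> set I3 = {}" "set I2 \<inter> set I3 = {}" using d by auto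
  ultimately show "theta_with_ends H u v" unfolding theta_with_ends_def using uv by metis
qed

context pair_graph
begin

text \<open>Since \<open>theta_on\<close> ignores the pair \<open>uv\<close>, its presence alone
  separates thetas from closed thetas.\<close>

lemma theta_iff:
  "theta G \<longleftrightarrow> (\<exists>u v I1 I2 I3. (u, v) \<notin> parcs G \<and> theta_on (parcs G) (pverts G) u v I1 I2 I3)"
proof -
  have "parcs G \<inter> pverts G \<times> pverts G - {(u, v), (v, u)} = parcs G" if "(u, v) \<notin> parcs G" for u v
    using that E_sym[of v u] parcs_subset by blast
  then show ?thesis
    unfolding theta_def theta_with_ends_iff theta_on_def by (metis (no_types, lifting))
qed

lemma closed_theta_iff:
  "closed_theta G \<longleftrightarrow> (\<exists>u v I1 I2 I3. (u, v) \<in> parcs G \<and> theta_on (parcs G) (pverts G) u v I1 I2 I3)"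
proof
  assume "closed_theta G"
  then obtain H u v where H: "theta_with_ends H u v"
      and G: "G = \<lparr>pverts = pverts H, parcs = parcs H \<union> {(u, v), (v, u)}\<rparr>"
    unfolding closed_theta_def by blast
  then obtain I1 I2 I3 where I: "(u, v) \<notin> parcs H" "I1 \<noteq> []" "I2 \<noteq> []" "I3 \<noteq> []"
      "distinct (u # v # I1 @ I2 @ I3)" "pverts H = {u, v} \<union> set I1 \<union> set I2 \<union> set I3"
      "parcs H = list_edges (u # I1 @ [v]) \<union> list_edges (u # I2 @ [v]) \<union> list_edges (u # I3 @ [v])"
    unfolding theta_with_ends_iff by blast
  have G': "pverts G = pverts H" "parcs G = parcs H \<union> {(u, v), (v, u)}" unfolding G by simp_all
  have "(v, u) \<notin> parcs H" using I(1) unfolding I(7) by (simp add: list_edges_sym[of v u])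
  then have "parcs G \<inter> pverts G \<times> pverts G - {(u, v), (v, u)} = parcs H"
    using I(1) parcs_subset unfolding G' by blast
  then have "theta_on (parcs G) (pverts G) u v I1 I2 I3"
    unfolding theta_on_def using I G'(1) by metis
  moreover have "(u, v) \<in> parcs G" using G'(2) by simp
  ultimately show "\<exists>u v I1 I2 I3. (u, v) \<in> parcs G \<and> theta_on (parcs G) (pverts G) u v I1 I2 I3"
    by blast
next
  assume "\<exists>u v I1 I2 I3. (u, v) \<in> parcs G \<and> theta_on (parcs G) (pverts G) u v I1 I2 I3"
  then obtain u v I1 I2 I3 where uv: "(u, v) \<in> parcs G"
    and t: "theta_on (parcs G) (pverts G) u v I1 I2 I3" by blast
  define H where "H = \<lparr>pverts = pverts G, parcs = parcs G - {(u, v), (v, u)}\<rparr>"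
  have "parcs G \<inter> pverts G \<times> pverts G = parcs G" using parcs_subset by blast
  then have "theta_with_ends H u v"
    using t unfolding theta_with_ends_iff theta_on_def H_def by (simp, metis)
  moreover have "G = \<lparr>pverts = pverts H, parcs = parcs H \<union> {(u, v), (v, u)}\<rparr>"
    by (rule pair_pre_digraph.equality) (use uv E_sym[OF uv] in \<open>auto simp: H_def\<close>)
  ultimately show "closed_theta G" unfolding closed_theta_def by blast
qed

lemma wheel_iff: "wheel G \<longleftrightarrow> (\<exists>w v. wheel_on (parcs G) (pverts G) w v)"
proof
  assume "wheel G"
  then obtain w v N where w: "distinct w" "3 \<le> length w" "v \<notin> set w" "N \<subseteq> set w" "3 \<le> card N"
    "G = \<lparr>pverts = insert v (set w), parcs = cycle_edges w \<union> {v} \<times> N \<union> N \<times> {v}\<rparr>"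
    unfolding wheel_def is_cycle_def by fastforce
  then have G: "pverts G = insert v (set w)" "parcs G = cycle_edges w \<union> {v} \<times> N \<union> N \<times> {v}"
    by (simp_all only: pair_pre_digraph.select_convs)
  have sub: "cycle_edges w \<subseteq> set w \<times> set w" by (rule cycle_edges_subset)
  then have "parcs G \<inter> set w \<times> set w = cycle_edges w" unfolding G using w(3) by blast
  moreover have "{y \<in> set w. (v, y) \<in> parcs G} = N" unfolding G using w(3,4) sub by blast
  ultimately have "wheel_on (parcs G) (pverts G) w v" unfolding wheel_on_def using w(1-5) G(1) by simp
  then show "\<exists>w v. wheel_on (parcs G) (pverts G) w v" by blast
next
  assume "\<exists>w v. wheel_on (parcs G) (pverts G) w v"
  then obtain w v where w: "distinct w" "3 \<le> length w" "parcs G \<inter> set w \<times> set w = cycle_edges w"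
      "v \<notin> set w" "3 \<le> card {y \<in> set w. (v, y) \<in> parcs G}" "pverts G = insert v (set w)"
    unfolding wheel_on_def by blast
  let ?W = "\<lparr>pverts = set w, parcs = cycle_edges w\<rparr>" and ?N = "{y \<in> set w. (v, y) \<in> parcs G}"
  have "parcs G = cycle_edges w \<union> {v} \<times> ?N \<union> ?N \<times> {v}"
  proof (intro equalityI subrelI)
    fix x y assume xy: "(x, y) \<in> parcs G"
    then have "x \<in> insert v (set w)" "y \<in> insert v (set w)" "x \<noteq> y"
      using parcs_subset w(6) E_irrefl by auto
    then show "(x, y) \<in> cycle_edges w \<union> {v} \<times> ?N \<union> ?N \<times> {v}"
      using xy E_sym[OF xy] unfolding w(3)[symmetric] by blast
  qed (use w(3) in \<open>auto intro: E_sym\<close>)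
  then have "G = \<lparr>pverts = insert v (pverts ?W), parcs = parcs ?W \<union> {v} \<times> ?N \<union> ?N \<times> {v}\<rparr>"
    by (intro pair_pre_digraph.equality) (use w(6) in auto)
  moreover have "is_cycle ?W" unfolding is_cycle_def using w(1,2) by blast
  moreover have "v \<notin> pverts ?W" "?N \<subseteq> pverts ?W" using w(4) by auto
  ultimately show "wheel G" unfolding wheel_def using w(5) by blast
qed

section \<open>Classification of triangle-free obstructions\<close>

lemma theta_on_HC_obstruction:
  "theta_on (parcs G) (pverts G) u v I1 I2 I3 \<Longrightarrow> HC_obstruction G"
  unfolding HC_obstruction_iff
  using theta_on_two_conn theta_on_not_ham theta_on_minimal by metis

lemma wheel_on_HC_obstruction:
  "wheel_on (parcs G) (pverts G) w v \<Longrightarrow> no_triangle \<Longrightarrow> HC_obstruction G"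
  unfolding HC_obstruction_iff
  using wheel_on_two_conn wheel_on_not_ham wheel_on_minimal by metis

text \<open>The induced theta or wheel is itself 2-connected and non-Hamiltonian, so minimality of
  \<open>G\<close> forces it to be all of \<open>G\<close>.\<close>

lemma triangle_free_HC_obstruction:
  assumes ob: "HC_obstruction G" and tf: no_triangle
  shows "theta G \<or> closed_theta G \<or> wheel G"
proof -
  have G: "two_conn (parcs G) (pverts G)" "\<not> ham (parcs G) (pverts G)"
    and min: "\<And>S. S \<subseteq> pverts G \<Longrightarrow> two_conn (parcs G) S \<Longrightarrow> S = pverts G \<or> ham (parcs G) S"
    using ob unfolding HC_obstruction_iff by blast+
  have "\<not> ham_noncut (pverts G)" using G(2) unfolding ham_noncut_def ham_def by blast
  then have "contains_theta_or_wheel (pverts G)"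
    using triangle_free_ham_or_theta_or_wheel[OF G(1) tf] by blast
  then obtain T where T: "T \<subseteq> pverts G"
      "(\<exists>u v I1 I2 I3. theta_on (parcs G) T u v I1 I2 I3) \<or> (\<exists>w v. wheel_on (parcs G) T w v)"
    unfolding contains_theta_or_wheel_def by blast
  then have "two_conn (parcs G) T" "\<not> ham (parcs G) T"
    using theta_on_two_conn theta_on_not_ham wheel_on_two_conn wheel_on_not_ham tf by blast+
  then have "T = pverts G" using min T(1) by blast
  then show ?thesis
    using T(2) unfolding theta_iff closed_theta_iff wheel_iff by blast
qed

end

theorem theorem3:
  fixes G :: "'a pair_pre_digraph"
  assumes "pair_graph G"
  shows "(theta G \<longrightarrow> HC_obstruction G) \<and>
    (triangle_free G \<and> closed_theta G \<longrightarrow> HC_obstruction G) \<and>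
    (triangle_free G \<and> wheel G \<longrightarrow> HC_obstruction G) \<and>
    (triangle_free G \<longrightarrow> (HC_obstruction G \<longleftrightarrow> theta G \<or> closed_theta G \<or> wheel G))"
proof -
  interpret pair_graph G by (fact assms)
  have "theta G \<or> closed_theta G \<Longrightarrow> HC_obstruction G"
    unfolding theta_iff closed_theta_iff using theta_on_HC_obstruction by blast
  moreover have "triangle_free G \<Longrightarrow> wheel G \<Longrightarrow> HC_obstruction G"
    unfolding wheel_iff triangle_free_iff using wheel_on_HC_obstruction by blast
  ultimately show ?thesis
    using triangle_free_HC_obstruction triangle_free_iff by blast
qed

end
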